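(* Let $B$ be the closed unit ball of $\mathbb{R}^3$ and let $\mathcal{L}_B$ denote the uniform probability measure on $B$, i.e. $d\mathcal{L}_B=\frac{1}{|B|}\mathbf{1}_B\,dx$. Consider the problem $$\sup_{\gamma\in\Pi(\mathcal{L}_B,\mathcal{L}_B,\mathcal{L}_B)}\int_{B^3}\det(x,y,z)\,d\gamma(x,y,z).$$ For $x\in B$ let $S(x)=\{y\in\mathbb{S}^2:\langle x,y\rangle=0\}$. Then this problem admits a solution $\bar\gamma$ given by: for every continuous $f:B^3\to\mathbb{R}$, $$\int_{B^3}f\,d\bar\gamma=\frac{1}{|B|}\int_B\left(\int_{S(x)}f\bigl(x,|x|y,x\wedge y\bigr)\frac{d\mathcal{H}^1(y)}{2\pi}\right)dx .$$
   Context: $x\wedge y$ denotes the cross product in $\mathbb{R}^3$, $\mathcal{H}^1$ the one-dimensional Hausdorff measure and $\mathbb{S}^2$ the unit sphere of $\mathbb{R}^3$. For probability measures $\mu_1,\dots,\mu_d$ on $\mathbb{R}^d$, $\Pi(\mu_1,\dots,\mu_d)$ denotes the set of Borel probability measures $\gamma$ on $(\mathbb{R}^d)^d$ whose $i$-th marginal $\pi_i\sharp\gamma$ equals $\mu_i$ for every $i$ (here $\pi_i$ is the $i$-th canonical projection and $\sharp$ denotes push-forward). A solution is an element of $\Pi(\mathcal{L}_B,\mathcal{L}_B,\mathcal{L}_B)$ attaining the supremum. *)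

theory Defs
  imports "HOL-Probability.Probability"
begin

type_synonym R3 = "real^3"

definition unitB :: "R3 set" where "unitB = cball 0 1"

definition LB :: "R3 measure" where "LB = uniform_measure lborel unitB"

definition det3 :: "R3 \<Rightarrow> R3 \<Rightarrow> R3 \<Rightarrow> real" where
  "det3 x y z = det (\<chi> i j. (if i = 1 then x else if i = 2 then y else z) $ j)"

definition couplings3 :: "R3 measure \<Rightarrow> R3 measure \<Rightarrow> R3 measure \<Rightarrow> (R3 \<times> R3 \<times> R3) measure set" where
  "couplings3 \<mu>1 \<mu>2 \<mu>3 = {\<gamma>. prob_space \<gamma> \<and> sets \<gamma> = sets borel \<and>
      distr \<gamma> borel (\<lambda>p. fst p) = \<mu>1 \<and>
      distr \<gamma> borel (\<lambda>p. fst (snd p)) = \<mu>2 \<and>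
      distr \<gamma> borel (\<lambda>p. snd (snd p)) = \<mu>3}"

definition is_solution :: "(R3 \<times> R3 \<times> R3) measure \<Rightarrow> bool" where
  "is_solution \<gamma> \<longleftrightarrow> \<gamma> \<in> couplings3 LB LB LB \<and>
     (\<forall>\<gamma>' \<in> couplings3 LB LB LB.
        (\<integral>p. det3 (fst p) (fst (snd p)) (snd (snd p)) \<partial>\<gamma>') \<le>
        (\<integral>p. det3 (fst p) (fst (snd p)) (snd (snd p)) \<partial>\<gamma>))"

text \<open>One-dimensional Hausdorff measure (normalisation: H^1 of a segment is its
  length), via delta-covers by countably many bounded sets.\<close>
definition hausdorff1_delta :: "real \<Rightarrow> 'a::metric_space set \<Rightarrow> ennreal" where
  "hausdorff1_delta \<delta> A = (INF C \<in> {C :: nat \<Rightarrow> 'a set. A \<subseteq> (\<Union>i. C i) \<and>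
       (\<forall>i. bounded (C i) \<and> diameter (C i) \<le> \<delta>)}. (\<Sum>i. ennreal (diameter (C i))))"

definition hausdorff1_outer :: "'a::metric_space set \<Rightarrow> ennreal" where
  "hausdorff1_outer A = (SUP \<delta> \<in> {0<..}. hausdorff1_delta \<delta> A)"

definition H1 :: "'a::metric_space measure" where
  "H1 = measure_of UNIV (sets borel) hausdorff1_outer"

definition Scirc :: "R3 \<Rightarrow> R3 set" where
  "Scirc x = {y. norm y = 1 \<and> inner x y = 0}"

end

theory Submission
  imports Defs
begin

text \<open>Optimality is the chain \<open>det (x, y, z) \<le> |x| |y| |z| \<le> (|x|\<^sup>3 + |y|\<^sup>3 + |z|\<^sup>3) / 3\<close>:
  the integral of the right-hand side depends only on the marginals, and both inequalities are
  equalities on triples \<open>(x, |x| y, x \<and> y)\<close> with \<open>y \<in> S(x)\<close>.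

  The candidate is realised as the law of such a triple, with \<open>x\<close> uniform in the ball and \<open>y\<close> a
  uniform angle on \<open>S(x)\<close> relative to a measurable orthonormal frame of the plane orthogonal to \<open>x\<close>.
  Since \<open>H\<^sup>1\<close> on the circle is the image of Lebesgue measure under every such angular
  parametrisation, the law does not depend on the frame and is invariant under
  rotations. Its second and third marginals are then rotation invariant with the radial
  law of the uniform measure on the ball, and these two properties determine a measure on \<open>\<real>\<^sup>3\<close>.\<close>

section \<open>One-dimensional Hausdorff measure on Borel sets\<close>

text \<open>\<open>H1\<close> is built with \<open>measure_of\<close>, which returns the zero
  measure unless the set function is countably additive on the Borel sets. Hence Caratheodory's
  criterion has to be settled before \<open>H1\<close> of any set can be computed. A tangent unit
  field on the sphere cannot be continuous, and no choice of frame commutes with all rotations: a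
  rotation about \<open>x\<close> fixes \<open>x\<close> but turns its frame. So invariance cannot
  be read off the parametrisation; it comes from identifying the law of the random angle with an
  object that mentions no frame, namely normalised arc length. Uniqueness of an invariant measure
  with given radial law is classically obtained by averaging over Haar measure on the rotation
  group. Here the law of the pair \<open>(x, y)\<close> replaces it: \<open>x / |x|\<close>,
  \<open>y\<close> and their cross product form a random right-handed orthonormal frame whose law is
  rotation invariant. One construction thus supplies both the coupling and the averaging device. On
  the support all three vectors have the same length, which is the equality case of the
  arithmetic-geometric mean inequality; the value of the problem is the mean of \<open>|x|^3\<close>
  over the ball.\<close>

lemma hausdorff1_delta_le:
  assumes "A \<subseteq> (\<Union>i. C i)" "\<And>i. bounded (C i)" "\<And>i. diameter (C i) \<le> \<delta>"
  shows "hausdorff1_delta \<delta> A \<le> (\<Sum>i. ennreal (diameter (C i)))"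
  unfolding hausdorff1_delta_def using assms by (intro INF_lower) auto

lemma hausdorff1_delta_mono:
  assumes "A \<subseteq> B"
  shows "hausdorff1_delta \<delta> A \<le> hausdorff1_delta \<delta> B"
  unfolding hausdorff1_delta_def using assms by (intro INF_superset_mono) auto

lemma hausdorff1_delta_antimono:
  assumes "\<delta> \<le> \<epsilon>"
  shows "hausdorff1_delta \<epsilon> A \<le> hausdorff1_delta \<delta> A"
  unfolding hausdorff1_delta_def using assms by (intro INF_superset_mono) (auto intro: order_trans)

lemma hausdorff1_delta_le_outer: "0 < \<delta> \<Longrightarrow> hausdorff1_delta \<delta> A \<le> hausdorff1_outer A"
  unfolding hausdorff1_outer_def by (intro SUP_upper) auto

lemma hausdorff1_outer_mono: "A \<subseteq> B \<Longrightarrow> hausdorff1_outer A \<le> hausdorff1_outer B"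
  unfolding hausdorff1_outer_def by (intro SUP_mono) (auto intro: hausdorff1_delta_mono)

lemma hausdorff1_outer_empty [simp]: "hausdorff1_outer {} = 0"
proof -
  have "hausdorff1_delta \<delta> ({}::'a set) \<le> 0" if "\<delta> > 0" for \<delta>
    using hausdorff1_delta_le[of "{}" "\<lambda>_. {}" \<delta>] that by simp
  then show ?thesis
    unfolding hausdorff1_outer_def by (intro antisym SUP_least) auto
qed

text \<open>Each \<open>A i\<close> gets a cover that is optimal up to \<open>e / 2^(i+1)\<close>;
  the double sequence of pieces is listed through \<open>prod_decode\<close>, and the errors add up
  to \<open>e\<close>.\<close>

lemma hausdorff1_delta_subadditive:
  fixes A :: "nat \<Rightarrow> 'a::metric_space set"
  shows "hausdorff1_delta \<delta> (\<Union>i. A i) \<le> (\<Sum>i. hausdorff1_delta \<delta> (A i))"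
proof (rule ennreal_le_epsilon)
  fix e :: real assume fin: "(\<Sum>i. hausdorff1_delta \<delta> (A i)) < top" and e: "0 < e"
  have finA: "hausdorff1_delta \<delta> (A i) < top" for i
    using ennreal_suminf_lessD[OF fin] .
  have "\<exists>C. A i \<subseteq> (\<Union>j. C j) \<and> (\<forall>j. bounded (C j) \<and> diameter (C j) \<le> \<delta>) \<and>
      (\<Sum>j. ennreal (diameter (C j))) \<le> hausdorff1_delta \<delta> (A i) + ennreal (e * (1/2)^Suc i)" for i
  proof -
    have "hausdorff1_delta \<delta> (A i) < hausdorff1_delta \<delta> (A i) + ennreal (e * (1/2)^Suc i)"
      using finA[of i] e by (auto simp: ennreal_zero_less_mult_iff)
    then show ?thesis
      unfolding hausdorff1_delta_def[of \<delta> "A i"] INF_less_iff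
      by (auto intro!: less_imp_le)
  qed
  then obtain C where C: "\<And>i. A i \<subseteq> (\<Union>j. C i j)" "\<And>i j. bounded (C i j)" "\<And>i j. diameter (C i j) \<le> \<delta>"
    and CS: "\<And>i. (\<Sum>j. ennreal (diameter (C i j))) \<le> hausdorff1_delta \<delta> (A i) + ennreal (e * (1/2)^Suc i)"
    by metis
  define D where "D k = (case prod_decode k of (i, j) \<Rightarrow> C i j)" for k
  have cover: "(\<Union>i. A i) \<subseteq> (\<Union>k. D k)"
  proof
    fix x assume "x \<in> (\<Union>i. A i)"
    then obtain i j where "x \<in> C i j" using C(1) by blast
    then have "x \<in> D (prod_encode (i, j))" by (simp add: D_def)
    then show "x \<in> (\<Union>k. D k)" by blast
  qed
  have "hausdorff1_delta \<delta> (\<Union>i. A i) \<le> (\<Sum>k. ennreal (diameter (D k)))"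
    by (rule hausdorff1_delta_le[OF cover]) (auto simp: D_def C split: prod.split)
  also have "\<dots> = (\<Sum>k. (\<lambda>(i,j). ennreal (diameter (C i j))) (prod_decode k))"
    by (simp add: D_def split_beta)
  also have "\<dots> = (\<Sum>i. \<Sum>j. ennreal (diameter (C i j)))"
    by (rule suminf_ennreal_2dimen) simp
  also have "\<dots> \<le> (\<Sum>i. hausdorff1_delta \<delta> (A i) + ennreal (e * (1/2)^Suc i))"
    by (intro suminf_le CS) auto
  also have "\<dots> = (\<Sum>i. hausdorff1_delta \<delta> (A i)) + (\<Sum>i. ennreal (e * (1/2)^Suc i))"
    by (rule suminf_add[symmetric]) auto
  also have "(\<Sum>i. ennreal (e * (1/2)^Suc i)) = ennreal e"
    using sums_mult[OF power_half_series, of e] e by (intro suminf_ennreal_eq) auto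
  finally show "hausdorff1_delta \<delta> (\<Union>i. A i) \<le> (\<Sum>i. hausdorff1_delta \<delta> (A i)) + ennreal e" .
qed

lemma hausdorff1_outer_subadditive:
  fixes A :: "nat \<Rightarrow> 'a::metric_space set"
  shows "hausdorff1_outer (\<Union>i. A i) \<le> (\<Sum>i. hausdorff1_outer (A i))"
  unfolding hausdorff1_outer_def[of "\<Union>i. A i"]
proof (rule SUP_least)
  fix \<delta> :: real assume "\<delta> \<in> {0<..}"
  then have "(\<Sum>i. hausdorff1_delta \<delta> (A i)) \<le> (\<Sum>i. hausdorff1_outer (A i))"
    by (intro suminf_le hausdorff1_delta_le_outer) auto
  with hausdorff1_delta_subadditive show "hausdorff1_delta \<delta> (\<Union>i. A i) \<le> (\<Sum>i. hausdorff1_outer (A i))"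
    by (rule order_trans)
qed

lemma outer_measure_space_hausdorff1:
  "outer_measure_space UNIV (hausdorff1_outer :: 'a::metric_space set \<Rightarrow> ennreal)"
  unfolding outer_measure_space_def positive_def increasing_def countably_subadditive_def
  by (auto simp: hausdorff1_outer_mono hausdorff1_outer_subadditive)

lemma hausdorff1_outer_Un_le: "hausdorff1_outer (A \<union> B) \<le> hausdorff1_outer A + hausdorff1_outer B"
proof -
  have "(\<Union>i. (if i = 0 then A else if i = Suc 0 then B else {})) = A \<union> B"
    by (auto split: if_splits)
  then have "hausdorff1_outer (A \<union> B) \<le> (\<Sum>i. hausdorff1_outer (if i = 0 then A else if i = Suc 0 then B else {}))"
    using hausdorff1_outer_subadditive[of "\<lambda>i. if i = 0 then A else if i = Suc 0 then B else {}"] by simp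
  also have "\<dots> = (\<Sum>i\<in>{0, Suc 0}. hausdorff1_outer (if i = 0 then A else if i = Suc 0 then B else {}))"
    by (rule suminf_finite) auto
  finally show ?thesis by simp
qed

text \<open>When the mesh is below \<open>e\<close>, no piece of a cover can meet both sets. The
  cover therefore splits into a cover of \<open>A\<close> and a cover of \<open>B\<close> with no
  piece used twice. This is the metric outer measure property.\<close>

lemma hausdorff1_outer_separated:
  fixes A B :: "'a::metric_space set"
  assumes e: "0 < e" and sep: "\<And>x y. x \<in> A \<Longrightarrow> y \<in> B \<Longrightarrow> e \<le> dist x y"
  shows "hausdorff1_outer A + hausdorff1_outer B \<le> hausdorff1_outer (A \<union> B)"
proof -
  have key: "hausdorff1_delta \<delta> A + hausdorff1_delta \<delta> B \<le> hausdorff1_outer (A \<union> B)"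
    if \<delta>: "0 < \<delta>" "\<delta> < e" for \<delta>
  proof -
    have "hausdorff1_delta \<delta> A + hausdorff1_delta \<delta> B \<le> hausdorff1_delta \<delta> (A \<union> B)"
      unfolding hausdorff1_delta_def[of \<delta> "A \<union> B"]
    proof (rule INF_greatest, clarify)
      fix C :: "nat \<Rightarrow> 'a set" assume C: "A \<union> B \<subseteq> (\<Union>i. C i)" "\<forall>i. bounded (C i) \<and> diameter (C i) \<le> \<delta>"
      have not_both: "\<not> (C i \<inter> A \<noteq> {} \<and> C i \<inter> B \<noteq> {})" for i
      proof (rule notI, elim conjE)
        assume "C i \<inter> A \<noteq> {}" "C i \<inter> B \<noteq> {}"
        then obtain x y where "x \<in> C i" "x \<in> A" "y \<in> C i" "y \<in> B" by blast
        then have "dist x y \<le> diameter (C i)" "e \<le> dist x y"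
          using C(2) by (auto intro: diameter_bounded_bound sep)
        moreover have "diameter (C i) \<le> \<delta>" using C(2) by simp
        ultimately show False using \<delta> by simp
      qed
      define CA where "CA i = (if C i \<inter> A \<noteq> {} then C i else {})" for i
      define CB where "CB i = (if C i \<inter> B \<noteq> {} then C i else {})" for i
      have "hausdorff1_delta \<delta> A \<le> (\<Sum>i. ennreal (diameter (CA i)))"
      proof (rule hausdorff1_delta_le)
        show "A \<subseteq> (\<Union>i. CA i)"
        proof
          fix x assume "x \<in> A"
          then obtain i where "x \<in> C i" using C(1) by blast
          with \<open>x \<in> A\<close> have "x \<in> CA i" by (auto simp: CA_def)
          then show "x \<in> (\<Union>i. CA i)" by blast
        qed
      qed (use C(2) \<delta> in \<open>auto simp: CA_def\<close>)
      moreover have "hausdorff1_delta \<delta> B \<le> (\<Sum>i. ennreal (diameter (CB i)))"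
      proof (rule hausdorff1_delta_le)
        show "B \<subseteq> (\<Union>i. CB i)"
        proof
          fix x assume "x \<in> B"
          then obtain i where "x \<in> C i" using C(1) by blast
          with \<open>x \<in> B\<close> have "x \<in> CB i" by (auto simp: CB_def)
          then show "x \<in> (\<Union>i. CB i)" by blast
        qed
      qed (use C(2) \<delta> in \<open>auto simp: CB_def\<close>)
      ultimately have "hausdorff1_delta \<delta> A + hausdorff1_delta \<delta> B
          \<le> (\<Sum>i. ennreal (diameter (CA i))) + (\<Sum>i. ennreal (diameter (CB i)))"
        by (rule add_mono)
      also have "\<dots> = (\<Sum>i. ennreal (diameter (CA i)) + ennreal (diameter (CB i)))"
        by (rule suminf_add) auto
      also have "\<dots> \<le> (\<Sum>i. ennreal (diameter (C i)))"
        using not_both by (intro suminf_le) (auto simp: CA_def CB_def)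
      finally show "hausdorff1_delta \<delta> A + hausdorff1_delta \<delta> B \<le> (\<Sum>i. ennreal (diameter (C i)))" .
    qed
    also have "\<dots> \<le> hausdorff1_outer (A \<union> B)"
      using \<delta> by (intro hausdorff1_delta_le_outer)
    finally show ?thesis .
  qed
  \<comment> \<open>The two outer measures are suprema over independent meshes, so the bound is
    needed for two different ones. Both are refined to a common mesh; \<open>e/2\<close> keeps it
    strictly below \<open>e\<close>.\<close>
  have key2: "hausdorff1_delta \<delta> A + hausdorff1_delta \<delta>' B \<le> hausdorff1_outer (A \<union> B)"
    if "0 < \<delta>" "0 < \<delta>'" for \<delta> \<delta>'
  proof -
    define m where "m = min (min \<delta> \<delta>') (e/2)"
    have "hausdorff1_delta \<delta> A + hausdorff1_delta \<delta>' B \<le> hausdorff1_delta m A + hausdorff1_delta m B"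
      by (intro add_mono hausdorff1_delta_antimono) (auto simp: m_def)
    also have "\<dots> \<le> hausdorff1_outer (A \<union> B)"
      by (rule key) (use e that in \<open>auto simp: m_def min_def\<close>)
    finally show ?thesis .
  qed
  have ne: "{0<..} \<noteq> ({} :: real set)" by auto
  show ?thesis
    unfolding hausdorff1_outer_def[of A] hausdorff1_outer_def[of B]
    by (subst ennreal_SUP_add_left[symmetric, OF ne], rule SUP_least,
        subst ennreal_SUP_add_right[OF ne], rule SUP_least) (auto intro: key2)
qed

text \<open>The shells \<open>R k\<close> at distance between \<open>1/(k+2)\<close> and \<open>1/(k+1)\<close> from the closed set are
  separated from each other when their indices have equal parity, so both parity classes
  have a convergent sum, and the sets at distance at least \<open>1/(n+1)\<close> exhaust the complement in measure.\<close>

lemma closed_caratheodory_hausdorff1: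
  fixes A X :: "'a::metric_space set"
  assumes "closed A"
  shows "hausdorff1_outer (X \<inter> A) + hausdorff1_outer (X - A) = hausdorff1_outer X"
proof (cases "A = {} \<or> hausdorff1_outer X = top")
  \<comment> \<open>Subadditivity settles an \<open>X\<close> of infinite measure. An empty
    \<open>A\<close> is set apart because \<open>infdist x {}\<close> is 0 by convention, so the
    shells below would not describe its complement.\<close>
  case True
  have "hausdorff1_outer ((X \<inter> A) \<union> (X - A)) \<le> hausdorff1_outer (X \<inter> A) + hausdorff1_outer (X - A)"
    by (rule hausdorff1_outer_Un_le)
  moreover have "(X \<inter> A) \<union> (X - A) = X" by auto
  ultimately show ?thesis using True by (auto simp: top_unique)
next
  case False
  let ?\<nu> = "hausdorff1_outer :: 'a set \<Rightarrow> ennreal"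
  have Ane: "A \<noteq> {}" and fin: "?\<nu> X < top" using False by (auto simp: less_top)
  define D where "D n = {x \<in> X. 1 / real (Suc n) \<le> infdist x A}" for n
  define R where "R k = {x \<in> X. 1 / real (Suc (Suc k)) \<le> infdist x A \<and> infdist x A < 1 / real (Suc k)}" for k
  have lip: "infdist x A \<le> infdist y A + dist x y" for x y
    by (rule infdist_triangle)
  have sep: "?\<nu> P + ?\<nu> Q \<le> ?\<nu> (P \<union> Q)"
    if "a < b" "\<And>x. x \<in> P \<Longrightarrow> infdist x A \<le> a" "\<And>x. x \<in> Q \<Longrightarrow> b \<le> infdist x A" for P Q a b
  proof (rule hausdorff1_outer_separated)
    show "0 < b - a" using that by simp
    fix x y assume "x \<in> P" "y \<in> Q"
    with that lip[of y x] show "b - a \<le> dist x y" by (fastforce simp: dist_commute)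
  qed
  have parity: "(\<Sum>k<n. ?\<nu> (R (2 * k + p))) \<le> ?\<nu> (\<Union>k<n. R (2 * k + p))" for n p
  proof (induction n)
    case (Suc n)
    have "(\<Sum>k<Suc n. ?\<nu> (R (2 * k + p))) \<le> ?\<nu> (R (2 * n + p)) + ?\<nu> (\<Union>k<n. R (2 * k + p))"
      using Suc by (simp add: add.commute add_left_mono)
    also have "\<dots> \<le> ?\<nu> (R (2 * n + p) \<union> (\<Union>k<n. R (2 * k + p)))"
    proof (rule sep)
      \<comment> \<open>Points of the new shell are at distance at most \<open>?a\<close>, those of
        the earlier shells of the same parity at least \<open>?b\<close>. For \<open>n = 0\<close>
        the union is empty and \<open>1 / real (2 * n + p)\<close> may be \<open>1 / 0 = 0\<close>;
        any number above 1 serves instead.\<close>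
      let ?a = "1 / real (Suc (2 * n + p))" and ?b = "if n = 0 then 2 else 1 / real (2 * n + p)"
      show "?a < ?b" by (auto simp: divide_simps)
      show "infdist x A \<le> ?a" if "x \<in> R (2 * n + p)" for x
        using that by (simp add: R_def)
      show "?b \<le> infdist x A" if x: "x \<in> (\<Union>k<n. R (2 * k + p))" for x
      proof -
        obtain k where k: "k < n" "x \<in> R (2 * k + p)" using x by auto
        then have "1 / real (2 * n + p) \<le> 1 / real (Suc (Suc (2 * k + p)))"
          by (intro divide_left_mono) auto
        then show ?thesis using k by (auto simp: R_def)
      qed
    qed
    finally show ?case by (simp add: lessThan_Suc)
  qed simp
  have parity_X: "(\<Sum>k<n. ?\<nu> (R (2 * k + p))) \<le> ?\<nu> X" for n p
    using parity by (rule order_trans) (auto simp: R_def intro!: hausdorff1_outer_mono)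
  have sum2: "(\<Sum>k<2*n. ?\<nu> (R k)) = (\<Sum>k<n. ?\<nu> (R (2 * k + 0))) + (\<Sum>k<n. ?\<nu> (R (2 * k + 1)))" for n
    by (induction n) (auto simp: ac_simps)
  have "(\<Sum>k<n. ?\<nu> (R k)) \<le> ?\<nu> X + ?\<nu> X" for n
  proof -
    have "(\<Sum>k<n. ?\<nu> (R k)) \<le> (\<Sum>k<2*n. ?\<nu> (R k))"
      by (intro sum_mono2) auto
    also have "\<dots> \<le> ?\<nu> X + ?\<nu> X"
      unfolding sum2 by (intro add_mono parity_X)
    finally show ?thesis .
  qed
  then have "(\<Sum>k. ?\<nu> (R k)) \<le> ?\<nu> X + ?\<nu> X"
    by (subst suminf_eq_SUP) (auto intro: SUP_least)
  also have "\<dots> < top" using fin by (simp add: ennreal_add_eq_top less_top)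
  finally have finR: "(\<Sum>k. ?\<nu> (R k)) < top" .
  define r where "r k = enn2real (?\<nu> (R k))" for k
  have r: "?\<nu> (R k) = ennreal (r k)" for k
    using ennreal_suminf_lessD[OF finR, of k] by (simp add: r_def less_top)
  have "summable r"
    using finR by (intro summable_suminf_not_top) (simp_all add: r[symmetric], simp add: r_def)
  have "?\<nu> (X \<inter> A) + ?\<nu> (X - A) \<le> ?\<nu> X"
  proof (rule ennreal_le_epsilon)
    fix e :: real assume "0 < e"
    then obtain n where n: "norm (\<Sum>k. r (k + n)) < e"
      using suminf_exist_split[OF _ \<open>summable r\<close>] by blast
    have cover: "X - A \<subseteq> D n \<union> (\<Union>k. R (k + n))"
    proof
      fix x assume x: "x \<in> X - A"
      then have pos: "0 < infdist x A"
        using assms Ane infdist_nonneg[of x A] in_closed_iff_infdist_zero[of A x] by force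
      show "x \<in> D n \<union> (\<Union>k. R (k + n))"
      proof (cases "x \<in> D n")
        case notD: False
        \<comment> \<open>The least \<open>m\<close> with \<open>1 / (m + 1)\<close> at most the
          distance. It exceeds \<open>n\<close> because \<open>x\<close> is outside
          \<open>D n\<close>, and minimality puts \<open>x\<close> into the shell
          \<open>R (m - 1)\<close>.\<close>
        obtain m where m: "1 / real (Suc m) \<le> infdist x A" "\<And>j. j < m \<Longrightarrow> \<not> 1 / real (Suc j) \<le> infdist x A"
        proof -
          have "\<exists>m. 1 / real (Suc m) \<le> infdist x A"
            using reals_Archimedean[OF pos] by (auto simp: inverse_eq_divide intro: less_imp_le)
          then show thesis
            using that[of "LEAST m. 1 / real (Suc m) \<le> infdist x A"]
            by (metis (mono_tags, lifting) LeastI_ex not_less_Least)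
        qed
        have "n < m"
        proof (rule ccontr)
          assume "\<not> n < m"
          then have "1 / real (Suc n) \<le> 1 / real (Suc m)" by (intro divide_left_mono) auto
          with m(1) notD x show False by (auto simp: D_def)
        qed
        then obtain k where k: "m = Suc (k + n)" by (metis add.commute less_imp_Suc_add)
        have "x \<in> R (k + n)"
          using m(1) m(2)[of "k + n"] x unfolding k by (auto simp: R_def)
        then show ?thesis by blast
      qed simp
    qed
    have "?\<nu> (X - A) \<le> ?\<nu> (D n) + ?\<nu> (\<Union>k. R (k + n))"
      using hausdorff1_outer_mono[OF cover] hausdorff1_outer_Un_le order_trans by blast
    also have "?\<nu> (\<Union>k. R (k + n)) \<le> (\<Sum>k. ?\<nu> (R (k + n)))"
      by (rule hausdorff1_outer_subadditive)
    also have "\<dots> = ennreal (\<Sum>k. r (k + n))"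
      unfolding r using \<open>summable r\<close>
      by (intro suminf_ennreal2) (simp add: r_def, simp only: summable_iff_shift)
    also have "\<dots> \<le> ennreal e" using n by (intro ennreal_leI) simp
    finally have "?\<nu> (X \<inter> A) + ?\<nu> (X - A) \<le> ?\<nu> (X \<inter> A) + ?\<nu> (D n) + ennreal e"
      by (simp add: add_left_mono add.assoc)
    also have "?\<nu> (X \<inter> A) + ?\<nu> (D n) \<le> ?\<nu> ((X \<inter> A) \<union> D n)"
      by (rule sep[of 0 "1 / real (Suc n)"]) (auto simp: D_def)
    also have "\<dots> \<le> ?\<nu> X" by (rule hausdorff1_outer_mono) (auto simp: D_def)
    finally show "?\<nu> (X \<inter> A) + ?\<nu> (X - A) \<le> ?\<nu> X + ennreal e" by simp
  qed
  moreover have "?\<nu> X \<le> ?\<nu> (X \<inter> A) + ?\<nu> (X - A)"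
    using hausdorff1_outer_Un_le[of "X \<inter> A" "X - A"] by (simp add: Int_Diff_Un)
  ultimately show ?thesis by (rule antisym)
qed

lemma sets_H1 [simp, measurable_cong]: "sets (H1 :: 'a::metric_space measure) = sets borel"
  unfolding H1_def using sets.sigma_sets_eq[of "borel :: 'a measure"] by simp

lemma space_H1 [simp]: "space H1 = UNIV"
  unfolding H1_def by simp

text \<open>The sets satisfying Caratheodory's condition form a sigma-algebra on which the outer
  measure is countably additive. It contains the closed sets, hence the Borel sets, so
  \<open>measure_of\<close> does carry \<open>hausdorff1_outer\<close>.\<close>

lemma emeasure_H1:
  fixes A :: "'a::metric_space set"
  assumes "A \<in> sets borel"
  shows "emeasure H1 A = hausdorff1_outer A"
proof -
  let ?\<nu> = "hausdorff1_outer :: 'a set \<Rightarrow> ennreal"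
  interpret sigma_algebra "UNIV :: 'a set" UNIV
    using sigma_algebra_Pow[of "UNIV :: 'a set"] by simp
  define L where "L = lambda_system (UNIV :: 'a set) UNIV ?\<nu>"
  have ms: "measure_space UNIV L ?\<nu>"
    unfolding L_def by (rule caratheodory_lemma[OF outer_measure_space_hausdorff1])
  have "sigma_sets UNIV (Collect closed) \<subseteq> L"
  proof (rule sigma_algebra.sigma_sets_subset)
    show "sigma_algebra UNIV L" using ms by (simp add: measure_space_def)
    show "Collect closed \<subseteq> L"
      unfolding L_def lambda_system_eq using closed_caratheodory_hausdorff1 by auto
  qed
  then have "sets borel \<subseteq> L"
    by (simp add: borel_eq_closed)
  with ms have "countably_additive (sets borel) ?\<nu>"
    unfolding measure_space_def countably_additive_def by blast
  then show ?thesis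
    using emeasure_measure_of[OF H1_def, of A] assms
    by (simp add: positive_def)
qed

section \<open>Arc length on circles\<close>

text \<open>Under an expanding map each covering set pulls back to a set of reals of diameter at
  most \<open>diameter (C i) / K\<close>. The closed intervals spanned by these pullbacks cover
  \<open>A\<close>, and Lebesgue measure is subadditive. A single mesh suffices for a lower bound; 1
  is an arbitrary choice.\<close>

lemma lborel_le_hausdorff1_image:
  fixes \<phi> :: "real \<Rightarrow> 'a::metric_space"
  assumes A: "A \<in> sets borel" and K: "0 < K"
    and expand: "\<And>s t. s \<in> A \<Longrightarrow> t \<in> A \<Longrightarrow> K * \<bar>s - t\<bar> \<le> dist (\<phi> s) (\<phi> t)"
  shows "ennreal K * emeasure lborel A \<le> hausdorff1_outer (\<phi> ` A)"
proof -
  have "ennreal K * emeasure lborel A \<le> hausdorff1_delta 1 (\<phi> ` A)"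
    unfolding hausdorff1_delta_def
  proof (rule INF_greatest, clarify)
    fix C :: "nat \<Rightarrow> 'a set" assume C: "\<phi> ` A \<subseteq> (\<Union>i. C i)" "\<forall>i. bounded (C i) \<and> diameter (C i) \<le> 1"
    define S where "S i = {s \<in> A. \<phi> s \<in> C i}" for i :: nat
    \<comment> \<open>\<open>Inf\<close> and \<open>Sup\<close> of an empty set of reals are
      unspecified, hence the case distinction.\<close>
    define J where "J i = (if S i = {} then {} else {Inf (S i)..Sup (S i)})" for i
    have close: "\<bar>s - t\<bar> \<le> diameter (C i) / K" if "s \<in> S i" "t \<in> S i" for s t i
    proof -
      have "K * \<bar>s - t\<bar> \<le> dist (\<phi> s) (\<phi> t)" using that by (intro expand) (auto simp: S_def)
      also have "\<dots> \<le> diameter (C i)"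
        using that C(2) by (intro diameter_bounded_bound) (auto simp: S_def)
      finally show ?thesis using K by (simp add: field_simps)
    qed
    have bdd: "bdd_below (S i)" "bdd_above (S i)" for i
    proof -
      show "bdd_below (S i)"
      proof (cases "S i = {}")
        case False
        then obtain t where "t \<in> S i" by auto
        then show ?thesis using close[of _ i t] by (intro bdd_belowI[of _ "t - diameter (C i) / K"]) fastforce
      qed simp
      show "bdd_above (S i)"
      proof (cases "S i = {}")
        case False
        then obtain t where "t \<in> S i" by auto
        then show ?thesis using close[of _ i t] by (intro bdd_aboveI[of _ "t + diameter (C i) / K"]) fastforce
      qed simp
    qed
    have J: "ennreal K * emeasure lborel (J i) \<le> ennreal (diameter (C i))" for i
    proof (cases "S i = {}")
      case False
      have "Sup (S i) \<le> Inf (S i) + diameter (C i) / K"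
      proof (rule cSup_least[OF False])
        fix s assume s: "s \<in> S i"
        have "s - diameter (C i) / K \<le> Inf (S i)"
          using close[OF s] by (intro cInf_greatest[OF False]) fastforce
        then show "s \<le> Inf (S i) + diameter (C i) / K" by simp
      qed
      then have "K * (Sup (S i) - Inf (S i)) \<le> diameter (C i)"
        using K by (simp add: field_simps)
      moreover have "Inf (S i) \<le> Sup (S i)"
        using False bdd by (intro cInf_le_cSup)
      ultimately show ?thesis
        using False K by (simp add: J_def ennreal_mult[symmetric] ennreal_leI)
    qed (simp add: J_def)
    have "A \<subseteq> (\<Union>i. J i)"
    proof
      fix s assume "s \<in> A"
      then obtain i where "s \<in> S i" using C(1) by (auto simp: S_def)
      then have "s \<in> J i" using bdd by (auto simp: J_def intro: cInf_lower cSup_upper)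
      then show "s \<in> (\<Union>i. J i)" by blast
    qed
    then have "emeasure lborel A \<le> (\<Sum>i. emeasure lborel (J i))"
      by (intro order_trans[OF emeasure_mono emeasure_subadditive_countably]) (auto simp: J_def)
    then have "ennreal K * emeasure lborel A \<le> (\<Sum>i. ennreal K * emeasure lborel (J i))"
      by (simp add: mult_left_mono)
    also have "\<dots> \<le> (\<Sum>i. ennreal (diameter (C i)))"
      by (intro suminf_le J) auto
    finally show "ennreal K * emeasure lborel A \<le> (\<Sum>i. ennreal (diameter (C i)))" .
  qed
  also have "\<dots> \<le> hausdorff1_outer (\<phi> ` A)" by (rule hausdorff1_delta_le_outer) simp
  finally show ?thesis .
qed

definition circ :: "'a::real_inner \<Rightarrow> 'a \<Rightarrow> real \<Rightarrow> 'a" where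
  "circ u v t = cos t *\<^sub>R u + sin t *\<^sub>R v"

lemma continuous_on_circ [continuous_intros]: "continuous_on S (circ u v)"
  unfolding circ_def by (intro continuous_intros)

lemma measurable_circ [measurable]: "circ u v \<in> borel_measurable borel"
  by (intro borel_measurable_continuous_onI continuous_on_circ)

definition orthopair :: "'a::real_inner \<Rightarrow> 'a \<Rightarrow> bool" where
  "orthopair u v \<longleftrightarrow> norm u = 1 \<and> norm v = 1 \<and> inner u v = 0"

lemma orthopair_inner:
  assumes "orthopair u v"
  shows "inner u u = 1" "inner v v = 1" "inner u v = 0" "inner v u = 0"
  using assms by (auto simp: orthopair_def norm_eq_1 inner_commute)

text \<open>The chord formula. The half-angle form yields at once that \<open>circ\<close> is
  1-Lipschitz, injective on one period, and nearly isometric on short arcs.\<close>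

lemma dist_circ:
  assumes "orthopair u v"
  shows "dist (circ u v s) (circ u v t) = 2 * \<bar>sin ((s - t) / 2)\<bar>"
proof -
  have "(dist (circ u v s) (circ u v t))\<^sup>2 = (cos s - cos t)\<^sup>2 + (sin s - sin t)\<^sup>2"
    unfolding dist_norm power2_norm_eq_inner circ_def
    by (simp add: inner_diff inner_add orthopair_inner[OF assms] power2_eq_square algebra_simps)
  also have "\<dots> = 2 - 2 * cos (s - t)"
    using sin_cos_squared_add[of s] sin_cos_squared_add[of t]
    by (simp add: cos_diff power2_eq_square algebra_simps)
  also have "\<dots> = (2 * \<bar>sin ((s - t) / 2)\<bar>)\<^sup>2"
  proof -
    have "2 * ((s - t) / 2) = s - t" by simp
    then show ?thesis
      using cos_double_sin[of "(s - t) / 2"] by (simp only: power_mult_distrib power2_abs) simp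
  qed
  finally show ?thesis
    by (rule power2_eq_imp_eq) auto
qed

lemma dist_circ_le:
  assumes "orthopair u v"
  shows "dist (circ u v s) (circ u v t) \<le> \<bar>s - t\<bar>"
  using abs_sin_x_le_abs_x[of "(s - t) / 2"] by (simp add: dist_circ[OF assms])

lemma inj_on_circ:
  assumes "orthopair u v"
  shows "inj_on (circ u v) {0..<2*pi}"
proof (rule inj_onI)
  fix s t assume st: "s \<in> {0..<2*pi}" "t \<in> {0..<2*pi}" and "circ u v s = circ u v t"
  then have "sin ((s - t) / 2) = 0" using dist_circ[OF assms, of s t] by simp
  moreover have "0 \<le> s" "s < 2 * pi" "0 \<le> t" "t < 2 * pi"
    using st by auto
  then have "- (2 * pi) < s - t" "s - t < 2 * pi" by linarith+
  then have "- pi < (s - t) / 2" "(s - t) / 2 < pi"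
    by (simp_all add: pos_less_divide_eq pos_divide_less_eq mult.commute)
  ultimately have "(s - t) / 2 = 0" using sin_eq_0_pi[of "(s - t) / 2"] by blast
  then show "s = t" by simp
qed

text \<open>A continuous image of a Borel set need not be Borel, but a half-open interval is a
  countable union of compact ones, whose images are compact.\<close>

lemma circ_arc_borel: "circ u v ` {a..<b} \<in> sets borel"
proof -
  have "{a..<b} = (\<Union>n. {a..b - 1 / real (Suc n)})"
  proof (safe)
    fix x assume x: "x \<in> {a..<b}"
    then obtain n where "inverse (real (Suc n)) < b - x" using reals_Archimedean[of "b - x"] by auto
    then show "x \<in> (\<Union>n. {a..b - 1 / real (Suc n)})" using x
      by (auto simp: inverse_eq_divide intro!: exI[of _ n])
  next
    fix x n assume "x \<in> {a..b - 1 / real (Suc n)}"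
    moreover have "0 < 1 / real (Suc n)" by simp
    ultimately show "x \<in> {a..<b}" unfolding atLeastAtMost_iff atLeastLessThan_iff by linarith
  qed
  then have "circ u v ` {a..<b} = (\<Union>n. circ u v ` {a..b - 1 / real (Suc n)})"
    by (simp add: image_UN)
  moreover have "circ u v ` {a..b - 1 / real (Suc n)} \<in> sets borel" for n
    by (intro borel_closed compact_imp_closed compact_continuous_image continuous_on_circ compact_Icc)
  ultimately show ?thesis by auto
qed

lemma Ico_split_equal:
  fixes l :: real
  assumes "0 < N" "0 < l"
  shows "{0..<l} = (\<Union>k<N. {l * real k / real N ..< l * real (Suc k) / real N})"
    and "disjoint_family (\<lambda>k. {l * real k / real N ..< l * real (Suc k) / real N})"
proof -
  have N: "0 < real N" using assms by simp
  have mono: "l * real i / real N \<le> l * real j / real N" if "i \<le> j" for i j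
    using that assms by (intro divide_right_mono mult_left_mono) auto
  show "{0..<l} = (\<Union>k<N. {l * real k / real N ..< l * real (Suc k) / real N})"
  proof safe
    fix x assume x: "x \<in> {0..<l}"
    define k where "k = nat \<lfloor>x * real N / l\<rfloor>"
    have k: "real k \<le> x * real N / l" "x * real N / l < real (Suc k)"
      using x assms by (simp_all add: k_def, linarith)
    have "x * real N / l < real N" using x assms by (simp add: field_simps)
    with k(1) have "k < N" by linarith
    moreover have "x \<in> {l * real k / real N ..< l * real (Suc k) / real N}"
      using k assms by (auto simp: field_simps)
    ultimately show "x \<in> (\<Union>k<N. {l * real k / real N ..< l * real (Suc k) / real N})" by blast
  next
    fix x k assume k: "k < N" and x: "x \<in> {l * real k / real N ..< l * real (Suc k) / real N}"
    show "x \<in> {0..<l}"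
      using mono[of "Suc k" N] mono[of 0 k] k x N assms
      by (auto simp del: of_nat_Suc intro: order_trans[of 0 "l * real k / real N"])
  qed
  show "disjoint_family (\<lambda>k. {l * real k / real N ..< l * real (Suc k) / real N})"
    unfolding disjoint_family_on_def
  proof (intro ballI impI, rule ccontr)
    fix i j :: nat
    assume "i \<noteq> j" and ne: "{l * real i / real N ..< l * real (Suc i) / real N} \<inter>
      {l * real j / real N ..< l * real (Suc j) / real N} \<noteq> {}"
    then have "Suc i \<le> j \<or> Suc j \<le> i" by auto
    with ne mono[of "Suc i" j] mono[of "Suc j" i] show False by fastforce
  qed
qed

text \<open>Cutting into \<open>N\<close> equal arcs gives pieces of diameter at most
  \<open>2 * pi / N\<close>, as \<open>circ\<close> is 1-Lipschitz. The total is
  \<open>2 * pi\<close> for every \<open>N\<close>, so \<open>N\<close> can be taken large enough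
  for any mesh.\<close>

lemma hausdorff1_circle_le:
  assumes "orthopair u v"
  shows "hausdorff1_outer (circ u v ` {0..<2*pi}) \<le> ennreal (2 * pi)"
  unfolding hausdorff1_outer_def
proof (rule SUP_least)
  fix \<delta> :: real assume "\<delta> \<in> {0<..}"
  then have "0 < \<delta> / (2 * pi)" by simp
  then obtain n where n: "inverse (real (Suc n)) < \<delta> / (2 * pi)" using reals_Archimedean by blast
  define N where "N = Suc n"
  have N: "0 < N" "2 * pi / real N \<le> \<delta>"
    using n by (auto simp: N_def field_simps)
  define C where "C k = (if k < N then circ u v ` {2*pi * real k / real N ..< 2*pi * real (Suc k) / real N} else {})" for k
  have diam: "diameter (C k) \<le> 2 * pi / real N" for k
  proof (rule diameter_le)
    show "C k \<noteq> {} \<or> 0 \<le> 2 * pi / real N" by simp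
    fix x y assume "x \<in> C k" "y \<in> C k"
    then obtain s t where st: "x = circ u v s" "y = circ u v t"
      "s \<in> {2*pi * real k / real N ..< 2*pi * real (Suc k) / real N}"
      "t \<in> {2*pi * real k / real N ..< 2*pi * real (Suc k) / real N}"
      by (auto simp: C_def split: if_splits)
    have "\<bar>s - t\<bar> \<le> 2*pi * real (Suc k) / real N - 2*pi * real k / real N"
      using st(3,4) by auto
    also have "\<dots> = 2 * pi / real N" by (simp add: diff_divide_distrib[symmetric] algebra_simps)
    finally show "norm (x - y) \<le> 2 * pi / real N"
      using dist_circ_le[OF assms, of s t] by (simp add: st dist_norm)
  qed
  have "hausdorff1_delta \<delta> (circ u v ` {0..<2*pi}) \<le> (\<Sum>k. ennreal (diameter (C k)))"
  proof (rule hausdorff1_delta_le)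
    show "circ u v ` {0..<2*pi} \<subseteq> (\<Union>k. C k)"
      using Ico_split_equal(1)[OF N(1), of "2*pi"] by (force simp: C_def)
    show "diameter (C k) \<le> \<delta>" for k using diam N(2) by (rule order_trans)
    show "bounded (C k)" for k
      by (rule bounded_subset[of "circ u v ` {2*pi * real k / real N .. 2*pi * real (Suc k) / real N}"])
        (auto simp: C_def intro!: compact_imp_bounded compact_continuous_image continuous_on_circ)
  qed
  also have "\<dots> = (\<Sum>k<N. ennreal (diameter (C k)))"
    by (rule suminf_finite) (auto simp: C_def)
  also have "\<dots> \<le> (\<Sum>k<N. ennreal (2 * pi / real N))"
    by (intro sum_mono ennreal_leI diam)
  also have "\<dots> = ennreal (2 * pi)"
    using N(1) by (simp add: ennreal_of_nat_eq_real_of_nat ennreal_mult[symmetric])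
  finally show "hausdorff1_delta \<delta> (circ u v ` {0..<2*pi}) \<le> ennreal (2 * pi)" .
qed

text \<open>Follows from \<open>sin x / x\<close> tending to 1 at 0. A factor \<open>K = 1\<close>
  is impossible, since chords are shorter than arcs; this forces the limit \<open>K\<close> to 1
  later on.\<close>

lemma circ_expand:
  assumes "orthopair u v" "0 < K" "K < 1"
  obtains d where "0 < d" "\<And>s t. \<bar>s - t\<bar> \<le> d \<Longrightarrow> K * \<bar>s - t\<bar> \<le> dist (circ u v s) (circ u v t)"
proof -
  have "((\<lambda>x::real. sin x / x) \<longlongrightarrow> 1) (at 0)"
    using DERIV_sin[of 0] by (simp add: has_field_derivative_iff)
  then have "eventually (\<lambda>x::real. K < sin x / x) (at 0)"
    using assms by (intro order_tendstoD)
  then obtain d where d: "0 < d" "\<And>x. x \<noteq> 0 \<Longrightarrow> \<bar>x\<bar> < d \<Longrightarrow> K < sin x / x"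
    by (auto simp: eventually_at dist_real_def)
  have "K * \<bar>s - t\<bar> \<le> dist (circ u v s) (circ u v t)" if "\<bar>s - t\<bar> \<le> d" for s t
  proof (cases "s = t")
    case False
    let ?x = "(s - t) / 2"
    have "K < sin ?x / ?x" using that False d(1) by (intro d(2)) auto
    also have "\<dots> \<le> \<bar>sin ?x / ?x\<bar>" by (rule abs_ge_self)
    finally have "K * \<bar>?x\<bar> \<le> \<bar>sin ?x\<bar>" using False by (simp add: abs_divide field_simps)
    then show ?thesis by (simp add: dist_circ[OF assms(1)])
  qed simp
  with d(1) show thesis by (rule that)
qed

text \<open>The circle is cut into arcs so short that \<open>circ\<close> expands by at least
  \<open>K\<close> on each. The arcs are disjoint by injectivity, so the lower bounds add up;
  finally \<open>K\<close> tends to 1.\<close>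

lemma lborel_le_H1_circle:
  fixes u v :: "'a::real_inner"
  assumes uv: "orthopair u v" and E: "E \<in> sets borel"
  shows "emeasure lborel (circ u v -` E \<inter> {0..<2*pi}) \<le> emeasure H1 (E \<inter> circ u v ` {0..<2*pi})"
proof -
  let ?m = "emeasure lborel (circ u v -` E \<inter> {0..<2*pi})" and ?h = "emeasure H1 (E \<inter> circ u v ` {0..<2*pi})"
  have vimE: "circ u v -` E \<in> sets borel"
    using measurable_sets[OF measurable_circ E, of u v] by simp
  have K: "ennreal K * ?m \<le> ?h" if K: "0 < K" "K < 1" for K
  proof -
    obtain d where d: "0 < d" "\<And>s t. \<bar>s - t\<bar> \<le> d \<Longrightarrow> K * \<bar>s - t\<bar> \<le> dist (circ u v s) (circ u v t)"
      using circ_expand[OF uv K] by blast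
    have "0 < d / (2 * pi)" using d by simp
    then obtain n where n: "inverse (real (Suc n)) < d / (2 * pi)" using reals_Archimedean by blast
    define N where "N = Suc n"
    have N: "0 < N" "2 * pi / real N \<le> d" using n by (auto simp: N_def field_simps)
    define I where "I k = {2*pi * real k / real N ..< 2*pi * real (Suc k) / real N}" for k
    have I: "{0..<2*pi} = (\<Union>k<N. I k)" and disj: "disjoint_family I"
      using Ico_split_equal[OF N(1), of "2*pi"] unfolding I_def by simp_all
    have Ib: "I k \<in> sets borel" for k by (simp add: I_def)
    have "?m = emeasure lborel (\<Union>k<N. circ u v -` E \<inter> I k)"
      unfolding I by (rule arg_cong[of _ _ "emeasure lborel"]) blast
    also have "\<dots> = (\<Sum>k<N. emeasure lborel (circ u v -` E \<inter> I k))"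
      using disj vimE
      by (intro sum_emeasure[symmetric]) (auto simp: Ib disjoint_family_on_def disjoint_iff)
    finally have "ennreal K * ?m = (\<Sum>k<N. ennreal K * emeasure lborel (circ u v -` E \<inter> I k))"
      by (simp add: sum_distrib_left)
    also have "\<dots> \<le> (\<Sum>k<N. emeasure H1 (E \<inter> circ u v ` I k))"
    proof (rule sum_mono)
      fix k
      have "ennreal K * emeasure lborel (circ u v -` E \<inter> I k) \<le> hausdorff1_outer (circ u v ` (circ u v -` E \<inter> I k))"
      proof (rule lborel_le_hausdorff1_image)
        show "circ u v -` E \<inter> I k \<in> sets borel" using vimE by (auto simp: I_def)
        fix s t assume st: "s \<in> circ u v -` E \<inter> I k" "t \<in> circ u v -` E \<inter> I k"
        have "\<bar>s - t\<bar> \<le> 2*pi * real (Suc k) / real N - 2*pi * real k / real N"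
          using st by (auto simp: I_def)
        also have "\<dots> = 2 * pi / real N" by (simp add: diff_divide_distrib[symmetric] algebra_simps)
        finally show "K * \<bar>s - t\<bar> \<le> dist (circ u v s) (circ u v t)" using N(2) by (intro d(2)) simp
      qed (use K in auto)
      also have "circ u v ` (circ u v -` E \<inter> I k) = E \<inter> circ u v ` I k" by auto
      also have "hausdorff1_outer \<dots> = emeasure H1 (E \<inter> circ u v ` I k)"
        using E by (intro emeasure_H1[symmetric]) (auto simp: I_def circ_arc_borel)
      finally show "ennreal K * emeasure lborel (circ u v -` E \<inter> I k) \<le> emeasure H1 (E \<inter> circ u v ` I k)" .
    qed
    also have "\<dots> = emeasure H1 (\<Union>k<N. E \<inter> circ u v ` I k)"
    proof (rule sum_emeasure)
      show "(\<lambda>k. E \<inter> circ u v ` I k) ` {..<N} \<subseteq> sets H1"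
        using E by (auto simp: I_def circ_arc_borel)
      show "disjoint_family_on (\<lambda>k. E \<inter> circ u v ` I k) {..<N}"
        unfolding disjoint_family_on_def
      proof (intro ballI impI)
        fix i j assume ij: "i \<in> {..<N}" "j \<in> {..<N}" "i \<noteq> j"
        have "circ u v ` I i \<inter> circ u v ` I j = circ u v ` (I i \<inter> I j)"
          using ij I by (intro inj_on_image_Int[OF inj_on_circ[OF uv], symmetric]) auto
        also have "I i \<inter> I j = {}" using disj ij by (auto simp: disjoint_family_on_def)
        finally show "(E \<inter> circ u v ` I i) \<inter> (E \<inter> circ u v ` I j) = {}" by blast
      qed
    qed auto
    also have "(\<Union>k<N. E \<inter> circ u v ` I k) = E \<inter> circ u v ` {0..<2*pi}"
      unfolding I by auto
    finally show ?thesis .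
  qed
  have "?m \<le> emeasure lborel {0..<2*pi}" by (intro emeasure_mono) auto
  then have fin: "?m < top" by (simp add: le_less_trans)
  show ?thesis
  proof (cases "?h = top")
    case False
    obtain m h where mh: "?m = ennreal m" "?h = ennreal h" "0 \<le> m" "0 \<le> h"
      using fin False by (metis ennreal_cases less_top)
    have "m \<le> h"
    proof (rule field_le_mult_one_interval)
      fix K :: real assume "0 < K" "K < 1"
      with K[of K] mh show "K * m \<le> h" by (simp add: ennreal_mult[symmetric])
    qed
    then show ?thesis by (simp add: mh ennreal_leI)
  qed simp
qed

text \<open>An upper bound is known only for the whole circle. The lower bound holds for both
  \<open>E\<close> and its complement, and the two totals are at most \<open>2 * pi\<close> and
  exactly \<open>2 * pi\<close>; as everything is finite, neither lower bound can be strict.\<close>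

lemma emeasure_H1_circle:
  fixes u v :: "'a::real_inner"
  assumes uv: "orthopair u v" and E: "E \<in> sets borel"
  shows "emeasure H1 (E \<inter> circ u v ` {0..<2*pi}) = emeasure lborel (circ u v -` E \<inter> {0..<2*pi})"
proof -
  let ?Z = "circ u v ` {0..<2*pi}" and ?I = "{0..<2*pi}"
  have Z: "?Z \<in> sets borel" by (rule circ_arc_borel)
  have vim: "circ u v -` E \<in> sets borel" if "E \<in> sets borel" for E
    using measurable_sets[OF measurable_circ that, of u v] by simp
  have "emeasure H1 (E \<inter> ?Z) + emeasure H1 (- E \<inter> ?Z) = emeasure H1 ?Z"
    using E Z by (subst plus_emeasure) (auto intro!: arg_cong[of _ _ "emeasure H1"])
  also have "\<dots> \<le> ennreal (2 * pi)"
    using hausdorff1_circle_le[OF uv] by (simp add: emeasure_H1[OF Z])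
  also have "\<dots> = emeasure lborel ?I" by simp
  also have "emeasure lborel ?I = emeasure lborel ((circ u v -` E \<inter> ?I) \<union> (circ u v -` (- E) \<inter> ?I))"
    by (rule arg_cong[of _ _ "emeasure lborel"]) auto
  also have "\<dots> = emeasure lborel (circ u v -` E \<inter> ?I) + emeasure lborel (circ u v -` (- E) \<inter> ?I)"
    using vim[OF E] vim[of "- E"] E by (intro plus_emeasure[symmetric]) auto
  finally have le: "emeasure H1 (E \<inter> ?Z) + emeasure H1 (- E \<inter> ?Z)
      \<le> emeasure lborel (circ u v -` E \<inter> ?I) + emeasure lborel (circ u v -` (- E) \<inter> ?I)" .
  have fin: "emeasure lborel (circ u v -` F \<inter> ?I) < top" for F
    by (rule le_less_trans[OF emeasure_mono[of _ ?I]]) auto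
  have "emeasure lborel (circ u v -` (- E) \<inter> ?I) + emeasure H1 (E \<inter> ?Z)
      \<le> emeasure H1 (- E \<inter> ?Z) + emeasure H1 (E \<inter> ?Z)"
    using lborel_le_H1_circle[OF uv, of "- E"] E by (intro add_right_mono) auto
  also have "\<dots> \<le> emeasure lborel (circ u v -` (- E) \<inter> ?I) + emeasure lborel (circ u v -` E \<inter> ?I)"
    using le by (simp only: add.commute)
  finally have "emeasure H1 (E \<inter> ?Z) \<le> emeasure lborel (circ u v -` E \<inter> ?I)"
    using fin[of "- E"] unfolding ennreal_add_left_cancel_le by auto
  with lborel_le_H1_circle[OF uv E] show ?thesis by (rule antisym[rotated])
qed

lemma density_H1_circle:
  assumes uv: "orthopair u v"
  shows "density H1 (indicator (circ u v ` {0..<2*pi}))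
       = distr (density lborel (indicator {0..<2*pi})) borel (circ u v)"
proof (rule measure_eqI)
  fix E assume "E \<in> sets (density H1 (indicator (circ u v ` {0..<2 * pi})))"
  then have E: "E \<in> sets borel" by simp
  have Z: "circ u v ` {0..<2*pi} \<in> sets borel" by (rule circ_arc_borel)
  have vim: "circ u v -` E \<in> sets borel"
    using measurable_sets[OF measurable_circ E, of u v] by simp
  have "emeasure (density H1 (indicator (circ u v ` {0..<2*pi}))) E = emeasure H1 (E \<inter> circ u v ` {0..<2*pi})"
    using E Z by (subst emeasure_density)
      (auto simp: indicator_inter_arith[symmetric] Int_commute intro!: nn_integral_indicator)
  also have "\<dots> = emeasure lborel (circ u v -` E \<inter> {0..<2*pi})"
    by (rule emeasure_H1_circle[OF uv E])
  also have "\<dots> = emeasure (distr (density lborel (indicator {0..<2*pi})) borel (circ u v)) E"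
    using E vim by (subst emeasure_distr, simp, simp, subst emeasure_density)
      (auto simp: indicator_inter_arith[symmetric] Int_commute intro!: nn_integral_indicator[symmetric])
  finally show "emeasure (density H1 (indicator (circ u v ` {0..<2*pi}))) E =
      emeasure (distr (density lborel (indicator {0..<2*pi})) borel (circ u v)) E" .
qed simp

lemma Scirc_eq_circ:
  assumes "x \<noteq> 0" "orthopair u v" "inner x u = 0" "inner x v = 0"
  shows "Scirc x = circ u v ` {0..<2*pi}"
proof (intro set_eqI iffI)
  fix y assume "y \<in> Scirc x"
  then have y: "norm y = 1" "inner x y = 0" by (auto simp: Scirc_def)
  note uv = orthopair_inner[OF assms(2)]
  define a b where "a = inner y u" and "b = inner y v"
  define w where "w = y - a *\<^sub>R u - b *\<^sub>R v"
  have w: "inner w x = 0" "inner w u = 0" "inner w v = 0"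
    using y assms uv by (auto simp: w_def a_def b_def inner_diff_left inner_diff_right inner_commute)
  \<comment> \<open>The component \<open>w\<close> of \<open>y\<close> orthogonal to
    \<open>u\<close> and \<open>v\<close> is also orthogonal to \<open>x\<close>. If it were
    nonzero, \<open>w\<close>, \<open>x\<close>, \<open>u\<close>, \<open>v\<close> would be four
    independent vectors in dimension three.\<close>
  have "w = 0"
  proof (rule ccontr)
    assume "w \<noteq> 0"
    have nz: "u \<noteq> 0" "v \<noteq> 0" using uv by auto
    have ne: "w \<noteq> x" "w \<noteq> u" "w \<noteq> v" "x \<noteq> u" "x \<noteq> v" "u \<noteq> v"
      using w assms uv \<open>w \<noteq> 0\<close> by auto
    have "independent {w, x, u, v}"
    proof (rule pairwise_orthogonal_independent)
      show "pairwise orthogonal {w, x, u, v}"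
        using w assms uv by (auto simp: pairwise_insert orthogonal_def inner_commute)
      show "0 \<notin> {w, x, u, v}" using nz assms \<open>w \<noteq> 0\<close> by auto
    qed
    then have "card {w, x, u, v} \<le> 3" using independent_bound[of "{w, x, u, v}"] by simp
    then show False using ne by simp
  qed
  then have yab: "y = a *\<^sub>R u + b *\<^sub>R v" by (simp add: w_def algebra_simps)
  have "inner y y = 1" using y by (simp add: norm_eq_1)
  then have "a\<^sup>2 + b\<^sup>2 = 1"
    unfolding yab by (simp add: inner_add uv power2_eq_square)
  then obtain t where "0 \<le> t" "t < 2 * pi" "a = cos t" "b = sin t"
    using sincos_total_2pi by blast
  then show "y \<in> circ u v ` {0..<2*pi}"
    by (auto simp: yab circ_def)
next
  fix y assume "y \<in> circ u v ` {0..<2*pi}"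
  then obtain t where y: "y = circ u v t" by auto
  have "inner y y = 1"
    by (simp add: y circ_def inner_add orthopair_inner[OF assms(2)] power2_eq_square[symmetric])
  then show "y \<in> Scirc x"
    using assms by (simp add: Scirc_def norm_eq_1) (simp add: y circ_def inner_add_right)
qed

section \<open>Uniform random angles and normalised arc length\<close>

definition angle :: "real measure" where "angle = uniform_measure lborel {0..<2*pi}"

lemma sets_angle [simp, measurable_cong]: "sets angle = sets borel"
  by (simp add: angle_def)

lemma space_angle [simp]: "space angle = UNIV"
  by (simp add: angle_def)

interpretation angle: prob_space angle
  unfolding angle_def by (rule prob_space_uniform_measure) (simp_all add: ennreal_eq_0_iff not_le)

lemma Scirc_measurable: "x \<noteq> 0 \<Longrightarrow> orthopair u v \<Longrightarrow> inner x u = 0 \<Longrightarrow> inner x v = 0 \<Longrightarrow> Scirc x \<in> sets borel"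
  by (simp add: Scirc_eq_circ circ_arc_borel)

text \<open>The right-hand side mentions only \<open>x\<close>. This is the source of every
  independence and invariance statement about frames below.\<close>

lemma distr_angle_circ:
  assumes "x \<noteq> 0" "orthopair u v" "inner x u = 0" "inner x v = 0"
  shows "distr angle borel (circ u v) = density H1 (\<lambda>y. indicator (Scirc x) y / ennreal (2 * pi))"
proof -
  have [measurable]: "Scirc x \<in> sets borel" using Scirc_measurable[OF assms] .
  have "distr angle borel (circ u v) = scale_measure (1 / ennreal (2 * pi)) (distr (density lborel (indicator {0..<2*pi})) borel (circ u v))"
    (is "?L = ?M")
  proof (rule measure_eqI)
    fix E assume "E \<in> sets ?L"
    then have E[measurable]: "E \<in> sets borel" by simp
    have [measurable]: "circ u v -` E \<in> sets borel"
      using measurable_sets[OF measurable_circ E, of u v] by simp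
    show "emeasure ?L E = emeasure ?M E"
      by (simp add: emeasure_distr angle_def emeasure_density nn_integral_indicator
          indicator_inter_arith[symmetric] divide_ennreal_def mult.commute Int_commute)
  qed simp
  also have "\<dots> = density H1 (\<lambda>y. indicator (Scirc x) y / ennreal (2 * pi))" (is "_ = ?R")
    unfolding density_H1_circle[OF assms(2), symmetric] Scirc_eq_circ[OF assms, symmetric]
  proof (rule measure_eqI)
    fix E assume "E \<in> sets (scale_measure (1 / ennreal (2 * pi)) (density H1 (indicator (Scirc x))))"
    then have [measurable]: "E \<in> sets borel" by simp
    show "emeasure (scale_measure (1 / ennreal (2 * pi)) (density H1 (indicator (Scirc x)))) E = emeasure ?R E"
      by (simp add: emeasure_density nn_integral_cmult[symmetric] divide_ennreal_def ac_simps)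
  qed simp
  finally show ?thesis .
qed

lemma distr_angle_circ_indep:
  fixes x :: R3
  assumes "x \<noteq> 0" "orthopair u v" "inner x u = 0" "inner x v = 0"
    and "orthopair u' v'" "inner x u' = 0" "inner x v' = 0"
  shows "distr angle borel (circ u v) = distr angle borel (circ u' v')"
  using assms by (simp add: distr_angle_circ[of x])

lemma nn_integral_angle_circ_indep:
  fixes x :: R3
  assumes "x \<noteq> 0" "orthopair u v" "inner x u = 0" "inner x v = 0"
    and "orthopair u' v'" "inner x u' = 0" "inner x v' = 0"
    and [measurable]: "h \<in> borel_measurable borel"
  shows "(\<integral>\<^sup>+t. h (circ u v t) \<partial>angle) = (\<integral>\<^sup>+t. h (circ u' v' t) \<partial>angle)"
proof -
  have "(\<integral>\<^sup>+y. h y \<partial>distr angle borel (circ u v)) = (\<integral>\<^sup>+y. h y \<partial>distr angle borel (circ u' v'))"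
    by (simp add: distr_angle_circ_indep[OF assms(1-7)])
  then show ?thesis by (simp add: nn_integral_distr)
qed

text \<open>Turns an average over angles into the inner Hausdorff integral of the theorem.\<close>

lemma integral_angle_circ:
  fixes x :: R3 and h :: "R3 \<Rightarrow> real"
  assumes x: "x \<noteq> 0" "orthopair u v" "inner x u = 0" "inner x v = 0"
    and [measurable]: "h \<in> borel_measurable borel"
  shows "(\<integral>t. h (circ u v t) \<partial>angle) = (LINT y : Scirc x | H1. h y / (2 * pi))"
proof -
  have [measurable]: "Scirc x \<in> sets borel" using Scirc_measurable[OF x] .
  have "(\<lambda>y. indicator (Scirc x) y / ennreal (2 * pi)) = (\<lambda>y. ennreal (indicator (Scirc x) y / (2 * pi)))"
    by (auto simp: divide_ennreal ennreal_1[symmetric] simp del: ennreal_1 split: split_indicator)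
  then have "(\<integral>t. h (circ u v t) \<partial>angle) = (\<integral>y. h y \<partial>density H1 (\<lambda>y. ennreal (indicator (Scirc x) y / (2 * pi))))"
    using integral_distr[of "circ u v" angle borel h] distr_angle_circ[OF x] by simp
  also have "\<dots> = (\<integral>y. (indicator (Scirc x) y / (2 * pi)) *\<^sub>R h y \<partial>H1)"
    by (rule integral_density) auto
  also have "\<dots> = (LINT y : Scirc x | H1. h y / (2 * pi))"
    unfolding set_lebesgue_integral_def by (intro Bochner_Integration.integral_cong) auto
  finally show ?thesis .
qed

section \<open>Uniform measure on the ball and orthonormal frames\<close>

lemma measure_unitB_pos: "0 < measure lborel unitB"
  unfolding unitB_def by (simp add: content_cball_pos)

lemma emeasure_unitB: "emeasure lborel unitB = ennreal (measure lborel unitB)"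
  unfolding unitB_def using emeasure_lborel_cball_finite[of "0::R3" 1]
  by (intro emeasure_eq_ennreal_measure) auto

lemma unitB_borel [measurable]: "unitB \<in> sets borel"
  by (simp add: unitB_def)

lemma sets_LB [simp, measurable_cong]: "sets LB = sets borel"
  by (simp add: LB_def)

lemma space_LB [simp]: "space LB = UNIV"
  by (simp add: LB_def)

interpretation LB: prob_space LB
  unfolding LB_def using measure_unitB_pos
  by (intro prob_space_uniform_measure) (auto simp: emeasure_unitB ennreal_eq_0_iff not_le)

lemma AE_LB: "AE x in LB. x \<noteq> 0 \<and> x \<in> unitB"
  unfolding LB_def
  by (rule AE_uniform_measureI) (use AE_lborel_singleton[of "0::R3"] in auto)

lemma orthogonal_transformation_measurable:
  fixes g :: "'a::euclidean_space \<Rightarrow> 'a"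
  assumes "orthogonal_transformation g"
  shows "g \<in> borel_measurable borel"
  using assms by (intro borel_measurable_continuous_onI linear_continuous_on)
    (simp add: orthogonal_transformation_linear linear_conv_bounded_linear[symmetric])

lemma distr_LB_orthogonal:
  assumes g: "orthogonal_transformation g"
  shows "distr LB borel g = LB"
proof (rule measure_eqI)
  fix A assume "A \<in> sets (distr LB borel g)"
  then have A[measurable]: "A \<in> sets borel" by simp
  note [measurable] = orthogonal_transformation_measurable[OF g]
  have gA: "g -` A \<in> sets borel"
    using measurable_sets[OF orthogonal_transformation_measurable[OF g] A] by simp
  have img: "g ` (unitB \<inter> g -` A) = unitB \<inter> A"
  proof (intro set_eqI iffI)
    fix y assume y: "y \<in> unitB \<inter> A"
    obtain x where x: "y = g x" using orthogonal_transformation_surj[OF g] by (metis surjD)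
    then show "y \<in> g ` (unitB \<inter> g -` A)"
      using y orthogonal_transformation_norm[OF g, of x] by (auto simp: unitB_def)
  next
    fix y assume "y \<in> g ` (unitB \<inter> g -` A)"
    then obtain x where "y = g x" "x \<in> unitB" "g x \<in> A" by blast
    then show "y \<in> unitB \<inter> A"
      using orthogonal_transformation_norm[OF g, of x] by (simp add: unitB_def)
  qed
  \<comment> \<open>The change of variables under \<open>g\<close> compares
    \<open>measure lebesgue\<close> of sets of finite measure. Intersecting with the ball ensures
    finiteness, and Borel sets have the same measure under \<open>lebesgue\<close> and
    \<open>lborel\<close>.\<close>
  have lm: "unitB \<inter> B \<in> lmeasurable" if "B \<in> sets borel" for B
    using that by (intro fmeasurable_Int_fmeasurable) (auto simp: unitB_def)
  have fin: "emeasure lborel (unitB \<inter> B) = ennreal (measure lebesgue (unitB \<inter> B))" if "B \<in> sets borel" for B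
  proof -
    have "emeasure lborel (unitB \<inter> B) = emeasure lebesgue (unitB \<inter> B)"
      using that by simp
    also have "\<dots> = ennreal (measure lebesgue (unitB \<inter> B))"
      using lm[OF that] by (simp add: emeasure_eq_measure2)
    finally show ?thesis .
  qed
  have "emeasure lborel (unitB \<inter> g -` A) = emeasure lborel (unitB \<inter> A)"
    using measure_orthogonal_image[OF g lm[OF gA]] by (simp add: fin gA img)
  then show "emeasure (distr LB borel g) A = emeasure LB A"
    using gA by (simp add: emeasure_distr LB_def)
qed simp

lemma nn_integral_LB_orthogonal:
  assumes "orthogonal_transformation g" "h \<in> borel_measurable borel"
  shows "(\<integral>\<^sup>+x. h (g x) \<partial>LB) = (\<integral>\<^sup>+x. h x \<partial>LB)"
  using nn_integral_distr[of g LB borel h] assms distr_LB_orthogonal[OF assms(1)]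
    orthogonal_transformation_measurable[OF assms(1)] by simp

text \<open>The horizontal unit vector \<open>(-x2, x1, 0) / sqrt (x1^2 + x2^2)\<close>, replaced by
  the first basis vector on the third coordinate axis, where that formula degenerates. Discontinuous
  on the axis, but Borel.\<close>

definition frame_u :: "R3 \<Rightarrow> R3" where
  "frame_u x = (if x$1 = 0 \<and> x$2 = 0 then axis 1 1
     else (1 / sqrt ((x$1)\<^sup>2 + (x$2)\<^sup>2)) *\<^sub>R (axis 2 (x$1) - axis 1 (x$2)))"

definition frame_v :: "R3 \<Rightarrow> R3" where
  "frame_v x = cross3 (x /\<^sub>R norm x) (frame_u x)"

lemma frame_u: "inner (frame_u x) (frame_u x) = 1" "inner x (frame_u x) = 0"
proof -
  have "(x$1)\<^sup>2 + (x$2)\<^sup>2 \<noteq> 0" if "\<not> (x$1 = 0 \<and> x$2 = 0)"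
    using that by (simp add: sum_power2_eq_zero_iff)
  then show "inner (frame_u x) (frame_u x) = 1" "inner x (frame_u x) = 0"
    by (auto simp: frame_u_def inner_vec_def sum_3 axis_def power2_eq_square[symmetric] power_divide
        real_sqrt_pow2 add_divide_distrib[symmetric] field_simps)
qed

lemma frame_uv:
  assumes "x \<noteq> 0"
  shows "orthopair (frame_u x) (frame_v x)" "inner x (frame_u x) = 0" "inner x (frame_v x) = 0"
proof -
  have n: "norm (x /\<^sub>R norm x) = 1" using assms by simp
  have ux: "inner (x /\<^sub>R norm x) (frame_u x) = 0" using frame_u by simp
  have u: "norm (frame_u x) = 1" using frame_u by (simp add: norm_eq_1)
  have "(norm (frame_v x))\<^sup>2 = 1"
    using norm_cross_dot[of "x /\<^sub>R norm x" "frame_u x"] by (simp add: frame_v_def n u ux del: norm_scaleR inner_scaleR_left)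
  then have v: "norm (frame_v x) = 1" by (simp add: power2_eq_1_iff) (metis norm_ge_zero not_one_le_zero neg_0_le_iff_le)
  show "inner x (frame_u x) = 0" by (rule frame_u)
  have "inner (x /\<^sub>R norm x) (frame_v x) = 0" by (simp add: frame_v_def dot_cross_self del: inner_scaleR_left)
  then show "inner x (frame_v x) = 0" using assms by simp
  show "orthopair (frame_u x) (frame_v x)"
    unfolding orthopair_def by (simp add: u v) (simp add: frame_v_def dot_cross_self)
qed

lemma measurable_vec_nth_R3 [measurable]: "(\<lambda>x::R3. x $ i) \<in> borel_measurable borel"
  by (intro borel_measurable_continuous_onI continuous_intros)

lemma measurable_axis [measurable]: "(\<lambda>a. axis i a :: R3) \<in> borel_measurable borel"
proof -
  have "(\<lambda>a. axis i a :: R3) = (\<lambda>a. a *\<^sub>R axis i 1)" by (auto simp: axis_def vec_eq_iff)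
  then show ?thesis by (rule ssubst) measurable
qed

lemma frame_u_measurable [measurable]: "frame_u \<in> borel_measurable borel"
  unfolding frame_u_def by measurable

lemma measurable_cross3 [measurable]:
  assumes "f \<in> borel_measurable M" "g \<in> borel_measurable M"
  shows "(\<lambda>x. cross3 (f x) (g x)) \<in> borel_measurable M"
proof -
  have "(\<lambda>p. cross3 (fst p) (snd p)) \<in> borel_measurable (borel \<Otimes>\<^sub>M borel)"
    unfolding borel_prod by (intro borel_measurable_continuous_onI continuous_on_cross continuous_intros)
  from measurable_compose[OF measurable_Pair[OF assms] this] show ?thesis by simp
qed

lemma frame_v_measurable [measurable]: "frame_v \<in> borel_measurable borel"
  unfolding frame_v_def by measurable

section \<open>The joint law of a point and a random orthogonal direction\<close>

definition fcirc :: "R3 \<Rightarrow> real \<Rightarrow> R3" where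
  "fcirc x = circ (frame_u x) (frame_v x)"

lemma fcirc_measurable [measurable]: "(\<lambda>p. fcirc (fst p) (snd p)) \<in> borel_measurable (borel \<Otimes>\<^sub>M borel)"
  unfolding fcirc_def circ_def by measurable

definition pairlaw :: "(R3 \<times> R3) measure" where
  "pairlaw = distr (LB \<Otimes>\<^sub>M angle) (borel \<Otimes>\<^sub>M borel) (\<lambda>p. (fst p, fcirc (fst p) (snd p)))"

lemma sets_pairlaw [simp, measurable_cong]: "sets pairlaw = sets (borel \<Otimes>\<^sub>M borel)"
  by (simp add: pairlaw_def)

lemma space_pairlaw [simp]: "space pairlaw = UNIV"
  by (simp add: pairlaw_def space_pair_measure)

interpretation LB_angle: pair_prob_space LB angle ..

interpretation pairlaw: prob_space pairlaw
  unfolding pairlaw_def by (rule LB_angle.prob_space_distr) measurable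

lemma nn_integral_pairlaw:
  assumes [measurable]: "h \<in> borel_measurable (borel \<Otimes>\<^sub>M borel)"
  shows "(\<integral>\<^sup>+p. h p \<partial>pairlaw) = (\<integral>\<^sup>+x. \<integral>\<^sup>+t. h (x, fcirc x t) \<partial>angle \<partial>LB)"
proof -
  have "(\<integral>\<^sup>+p. h p \<partial>pairlaw) = (\<integral>\<^sup>+p. h (fst p, fcirc (fst p) (snd p)) \<partial>(LB \<Otimes>\<^sub>M angle))"
    unfolding pairlaw_def by (rule nn_integral_distr) measurable
  also have "\<dots> = (\<integral>\<^sup>+x. \<integral>\<^sup>+t. h (x, fcirc x t) \<partial>angle \<partial>LB)"
    by (subst angle.nn_integral_fst[symmetric]) simp_all
  finally show ?thesis .
qed

lemma fcirc_Scirc: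
  assumes "x \<noteq> 0"
  shows "norm (fcirc x t) = 1" "inner x (fcirc x t) = 0"
proof -
  note uv = orthopair_inner[OF frame_uv(1)[OF assms]]
  have "inner (fcirc x t) (fcirc x t) = 1"
    by (simp add: fcirc_def circ_def inner_add uv power2_eq_square[symmetric])
  then show "norm (fcirc x t) = 1" by (simp add: norm_eq_1)
  show "inner x (fcirc x t) = 0"
    by (simp add: fcirc_def circ_def inner_add_right frame_uv[OF assms])
qed

text \<open>The origin must be left out: \<open>frame_v 0 = 0\<close>, so there \<open>fcirc\<close>
  does not run through a unit circle.\<close>

lemma AE_pairlaw:
  "AE p in pairlaw. fst p \<noteq> 0 \<and> fst p \<in> unitB \<and> norm (snd p) = 1 \<and> inner (fst p) (snd p) = 0"
proof -
  have "AE p in LB \<Otimes>\<^sub>M angle. fst p \<noteq> 0 \<and> fst p \<in> unitB"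
  proof (rule LB_angle.AE_pair_measure)
    show "{p \<in> space (LB \<Otimes>\<^sub>M angle). fst p \<noteq> 0 \<and> fst p \<in> unitB} \<in> sets (LB \<Otimes>\<^sub>M angle)"
      by measurable
    show "AE x in LB. AE t in angle. fst (x, t) \<noteq> 0 \<and> fst (x, t) \<in> unitB"
      using AE_LB by eventually_elim simp
  qed
  then show ?thesis
    unfolding pairlaw_def
    by (subst AE_distr_iff) (auto simp: fcirc_Scirc elim!: eventually_mono)
qed

text \<open>\<open>g\<close> carries the frame at \<open>x\<close> to an orthonormal frame of the
  plane orthogonal to \<open>g x\<close>. In general this is not the frame chosen at
  \<open>g x\<close>, but the law of the random point on the circle is the same for both; invariance
  of \<open>LB\<close> does the rest.\<close>

lemma nn_integral_pairlaw_orthogonal: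
  assumes g: "orthogonal_transformation g" and [measurable]: "h \<in> borel_measurable (borel \<Otimes>\<^sub>M borel)"
  shows "(\<integral>\<^sup>+p. h (g (fst p), g (snd p)) \<partial>pairlaw) = (\<integral>\<^sup>+p. h p \<partial>pairlaw)"
proof -
  note [measurable] = orthogonal_transformation_measurable[OF g]
  have lin: "linear g" by (rule orthogonal_transformation_linear[OF g])
  have gi: "inner (g a) (g b) = inner a b" for a b
    using g by (simp add: orthogonal_transformation_def)
  have gn: "norm (g a) = norm a" for a by (rule orthogonal_transformation_norm[OF g])
  have "(\<integral>\<^sup>+p. h (g (fst p), g (snd p)) \<partial>pairlaw) = (\<integral>\<^sup>+x. \<integral>\<^sup>+t. h (g x, g (fcirc x t)) \<partial>angle \<partial>LB)"
    by (subst nn_integral_pairlaw) simp_all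
  also have "\<dots> = (\<integral>\<^sup>+x. \<integral>\<^sup>+t. h (g x, fcirc (g x) t) \<partial>angle \<partial>LB)"
  proof (rule nn_integral_cong_AE)
    show "AE x in LB. (\<integral>\<^sup>+t. h (g x, g (fcirc x t)) \<partial>angle) = (\<integral>\<^sup>+t. h (g x, fcirc (g x) t) \<partial>angle)"
      using AE_LB
    proof eventually_elim
      fix x assume "x \<noteq> 0 \<and> x \<in> unitB"
      then have x: "x \<noteq> 0" by simp
      then have gx: "g x \<noteq> 0" using gn[of x] by auto
      have "g (fcirc x t) = circ (g (frame_u x)) (g (frame_v x)) t" for t
        by (simp add: fcirc_def circ_def linear_add[OF lin] linear_scale[OF lin])
      moreover have "(\<integral>\<^sup>+t. h (g x, circ (g (frame_u x)) (g (frame_v x)) t) \<partial>angle)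
          = (\<integral>\<^sup>+t. h (g x, circ (frame_u (g x)) (frame_v (g x)) t) \<partial>angle)"
        using frame_uv[OF x] frame_uv[OF gx]
        by (intro nn_integral_angle_circ_indep[of "g x"] gx) (simp_all add: orthopair_def gi gn)
      ultimately show "(\<integral>\<^sup>+t. h (g x, g (fcirc x t)) \<partial>angle) = (\<integral>\<^sup>+t. h (g x, fcirc (g x) t) \<partial>angle)"
        by (simp add: fcirc_def)
    qed
  qed
  also have "\<dots> = (\<integral>\<^sup>+x. \<integral>\<^sup>+t. h (x, fcirc x t) \<partial>angle \<partial>LB)"
    by (rule nn_integral_LB_orthogonal[OF g]) measurable
  also have "\<dots> = (\<integral>\<^sup>+p. h p \<partial>pairlaw)"
    by (simp add: nn_integral_pairlaw)
  finally show ?thesis .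
qed

section \<open>Averaging over random frames\<close>

definition frame_coords :: "R3 \<times> R3 \<Rightarrow> R3 \<Rightarrow> R3" where
  "frame_coords p z = axis 1 (inner (fst p /\<^sub>R norm (fst p)) z) + axis 2 (inner (snd p) z)
     + axis 3 (inner (cross3 (fst p /\<^sub>R norm (fst p)) (snd p)) z)"

lemma frame_coords_measurable [measurable]:
  "(\<lambda>q. frame_coords (fst q) (snd q)) \<in> borel_measurable ((borel \<Otimes>\<^sub>M borel) \<Otimes>\<^sub>M borel)"
  unfolding frame_coords_def by measurable

text \<open>\<open>frame_coords p\<close> is the coordinate map of the orthonormal frame formed by
  \<open>a = x / |x|\<close>, \<open>b = y\<close> and their cross product, so the claim is
  Parseval's identity for that frame.\<close>

lemma frame_coords_orthogonal:
  assumes "fst p \<noteq> 0" "norm (snd p) = 1" "inner (fst p) (snd p) = 0"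
  shows "orthogonal_transformation (frame_coords p)"
  unfolding orthogonal_transformation
proof (intro conjI allI)
  define a where "a = fst p /\<^sub>R norm (fst p)"
  define b where "b = snd p"
  have a: "norm a = 1" "norm b = 1" "inner a b = 0"
    using assms by (auto simp: a_def b_def)
  have fc: "frame_coords p z = axis 1 (inner a z) + axis 2 (inner b z) + axis 3 (inner (cross3 a b) z)" for z
    by (simp add: frame_coords_def a_def b_def)
  show "linear (frame_coords p)"
    by (rule linearI) (auto simp: fc vec_eq_iff axis_def inner_add_right)
  fix z
  \<comment> \<open>With \<open>c\<close> the cross product of \<open>a\<close> and
    \<open>b\<close>, Lagrange's identity splits \<open>|z|^2\<close> into the squared inner product
    of \<open>c\<close> and \<open>z\<close> plus the squared norm of their cross product. The
    triple product expansion shows the latter to be the sum of the squares of the first two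
    coordinates.\<close>
  have c: "(norm (cross3 a b))\<^sup>2 = 1" using norm_cross_dot[of a b] a by simp
  have tr: "cross3 (cross3 a b) z = inner a z *\<^sub>R b - inner b z *\<^sub>R a"
    by (simp add: cross3_simps forall_3)
  have "(norm (cross3 (cross3 a b) z))\<^sup>2 = (inner a z)\<^sup>2 + (inner b z)\<^sup>2"
    unfolding tr power2_norm_eq_inner using a
    by (simp add: inner_diff_left inner_diff_right norm_eq_1 inner_commute power2_eq_square)
  then have "(norm z)\<^sup>2 = (inner a z)\<^sup>2 + (inner b z)\<^sup>2 + (inner (cross3 a b) z)\<^sup>2"
    using norm_cross_dot[of "cross3 a b" z] c by (simp add: power_mult_distrib)
  also have "\<dots> = (norm (frame_coords p z))\<^sup>2"
    unfolding power2_norm_eq_inner fc by (simp add: inner_vec_def sum_3 axis_def power2_eq_square)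
  finally show "norm (frame_coords p z) = norm z"
    using power2_eq_imp_eq[of "norm (frame_coords p z)" "norm z"] by simp
qed

text \<open>Rotating frame and vector together leaves the coordinates alone. The determinant
  matters: a reflection would reverse the sign of the third coordinate, which involves the cross
  product.\<close>

lemma frame_coords_rotation:
  assumes g: "orthogonal_transformation g" "det (matrix g) = 1"
  shows "frame_coords (g (fst p), g (snd p)) (g z) = frame_coords p z"
proof -
  have "inner (g a) (g b) = inner a b" for a b
    using g by (simp add: orthogonal_transformation_def)
  moreover have "cross3 (g a) (g b) = g (cross3 a b)" for a b
    using cross_orthogonal_transformation[OF g(1)] g(2) by simp
  moreover have "g (fst p) /\<^sub>R norm (g (fst p)) = g (fst p /\<^sub>R norm (fst p))"
    using orthogonal_transformation_norm[OF g(1)] orthogonal_transformation_scaleR[OF g(1)] by simp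
  ultimately show ?thesis by (simp add: frame_coords_def)
qed

text \<open>Averaging over the frames plays the role of averaging over the Haar measure of the
  rotation group: the average of any function is radial.\<close>

definition frame_average :: "(R3 \<Rightarrow> ennreal) \<Rightarrow> R3 \<Rightarrow> ennreal" where
  "frame_average f z = (\<integral>\<^sup>+p. f (frame_coords p z) \<partial>pairlaw)"

lemma frame_average_measurable [measurable]:
  assumes [measurable]: "f \<in> borel_measurable borel"
  shows "frame_average f \<in> borel_measurable borel"
proof -
  have [measurable]: "(\<lambda>q. frame_coords (snd q) (fst q)) \<in> borel_measurable (borel \<Otimes>\<^sub>M pairlaw)"
    unfolding frame_coords_def by measurable
  show ?thesis unfolding frame_average_def
    by (rule pairlaw.borel_measurable_nn_integral) (simp add: split_beta')
qed

text \<open>Rotations act transitively on spheres, so some rotation takes \<open>z\<close> to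
  \<open>w\<close>. It may be moved from the vector onto the frames, whose law it preserves.\<close>

lemma frame_average_radial:
  assumes [measurable]: "f \<in> borel_measurable borel" and "norm z = norm w"
  shows "frame_average f z = frame_average f w"
proof -
  obtain g where g: "orthogonal_transformation g" "det (matrix g) = 1" "g z = w"
    using rotation_exists[of z w] assms by auto
  have [measurable]: "(\<lambda>p. frame_coords p w) \<in> borel_measurable (borel \<Otimes>\<^sub>M borel)"
    unfolding frame_coords_def by measurable
  have "frame_average f z = (\<integral>\<^sup>+p. f (frame_coords (g (fst p), g (snd p)) w) \<partial>pairlaw)"
    unfolding frame_average_def g(3)[symmetric] by (simp add: frame_coords_rotation[OF g(1,2)])
  also have "\<dots> = frame_average f w"
    unfolding frame_average_def
    by (rule nn_integral_pairlaw_orthogonal[OF g(1), of "\<lambda>p. f (frame_coords p w)"]) measurable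
  finally show ?thesis .
qed

text \<open>For almost every fixed \<open>p\<close> the map \<open>frame_coords p\<close> preserves
  \<open>M\<close>, so inserting it does not change the integral of \<open>f\<close>. Averaging over
  \<open>p\<close> and exchanging the integrals replaces \<open>f\<close> by its frame average,
  whose value at \<open>z\<close> may be taken at the point of length \<open>|z|\<close> on the
  first axis.\<close>

lemma nn_integral_eq_frame_average:
  assumes M: "prob_space M" "sets M = sets borel"
    and inv: "\<And>g. orthogonal_transformation g \<Longrightarrow> distr M borel g = M"
    and [measurable]: "f \<in> borel_measurable borel"
  shows "(\<integral>\<^sup>+z. f z \<partial>M) = (\<integral>\<^sup>+z. frame_average f (norm z *\<^sub>R axis 1 1) \<partial>M)"
proof -
  interpret M: prob_space M by fact
  interpret pair_sigma_finite pairlaw M ..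
  note [measurable_cong] = M(2)
  have "(\<integral>\<^sup>+z. f z \<partial>M) = (\<integral>\<^sup>+p. (\<integral>\<^sup>+z. f z \<partial>M) \<partial>pairlaw)"
    using pairlaw.emeasure_space_1 by simp
  also have "\<dots> = (\<integral>\<^sup>+p. (\<integral>\<^sup>+z. f (frame_coords p z) \<partial>M) \<partial>pairlaw)"
  proof (rule nn_integral_cong_AE)
    show "AE p in pairlaw. (\<integral>\<^sup>+z. f z \<partial>M) = (\<integral>\<^sup>+z. f (frame_coords p z) \<partial>M)"
      using AE_pairlaw
    proof eventually_elim
      case (elim p)
      then have g: "orthogonal_transformation (frame_coords p)"
        by (intro frame_coords_orthogonal) auto
      note [measurable] = orthogonal_transformation_measurable[OF g]
      have "(\<integral>\<^sup>+z. f (frame_coords p z) \<partial>M) = (\<integral>\<^sup>+z. f z \<partial>distr M borel (frame_coords p))"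
        by (simp add: nn_integral_distr)
      then show ?case by (simp add: inv[OF g])
    qed
  qed
  also have "\<dots> = (\<integral>\<^sup>+z. (\<integral>\<^sup>+p. f (frame_coords p z) \<partial>pairlaw) \<partial>M)"
    by (rule Fubini'[symmetric]) (simp add: split_beta')
  also have "\<dots> = (\<integral>\<^sup>+z. frame_average f (norm z *\<^sub>R axis 1 1) \<partial>M)"
    unfolding frame_average_def[symmetric]
    by (intro nn_integral_cong frame_average_radial) (simp_all add: norm_axis_1)
  finally show ?thesis .
qed

text \<open>By the averaging formula, the measure of any Borel set is an integral against the law of
  the norm alone.\<close>

lemma orthogonally_invariant_measure_eqI:
  fixes M N :: "R3 measure"
  assumes M: "prob_space M" "sets M = sets borel" "\<And>g. orthogonal_transformation g \<Longrightarrow> distr M borel g = M"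
    and N: "prob_space N" "sets N = sets borel" "\<And>g. orthogonal_transformation g \<Longrightarrow> distr N borel g = N"
    and radial: "distr M borel norm = distr N borel norm"
  shows "M = N"
proof (rule measure_eqI)
  show "sets M = sets N" using M N by simp
  fix A assume A: "A \<in> sets M"
  then have [measurable]: "A \<in> sets borel" using M by simp
  note [measurable_cong] = M(2) N(2)
  let ?f = "indicator A :: R3 \<Rightarrow> ennreal"
  have "emeasure M A = (\<integral>\<^sup>+z. frame_average ?f (norm z *\<^sub>R axis 1 1) \<partial>M)"
    using A by (simp add: nn_integral_eq_frame_average[OF M, of ?f, symmetric])
  also have "\<dots> = (\<integral>\<^sup>+r. frame_average ?f (r *\<^sub>R axis 1 1) \<partial>distr M borel norm)"
    by (simp add: nn_integral_distr)
  also have "\<dots> = (\<integral>\<^sup>+z. frame_average ?f (norm z *\<^sub>R axis 1 1) \<partial>N)"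
    by (simp add: radial nn_integral_distr)
  also have "\<dots> = emeasure N A"
    using A M(2) N(2) by (simp add: nn_integral_eq_frame_average[OF N, of ?f, symmetric])
  finally show "emeasure M A = emeasure N A" .
qed

section \<open>The optimal coupling\<close>

lemma distr_pairlaw_fst: "distr pairlaw borel fst = LB"
proof (rule measure_eqI)
  fix A assume "A \<in> sets (distr pairlaw borel fst)"
  then have [measurable]: "A \<in> sets borel" by simp
  have "emeasure (distr pairlaw borel fst) A = (\<integral>\<^sup>+y. indicator A y \<partial>distr pairlaw borel fst)"
    by simp
  also have "\<dots> = (\<integral>\<^sup>+p. indicator A (fst p) \<partial>pairlaw)"
    by (rule nn_integral_distr) measurable
  also have "\<dots> = (\<integral>\<^sup>+x. \<integral>\<^sup>+t. indicator A x \<partial>angle \<partial>LB)"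
    by (subst nn_integral_pairlaw) simp_all
  also have "\<dots> = (\<integral>\<^sup>+x. indicator A x \<partial>LB)"
    using angle.emeasure_space_1 by simp
  also have "\<dots> = emeasure LB A" by simp
  finally show "emeasure (distr pairlaw borel fst) A = emeasure LB A" .
qed simp

lemma distr_pairlaw_scaled: "distr pairlaw borel (\<lambda>p. norm (fst p) *\<^sub>R snd p) = LB"
proof (rule orthogonally_invariant_measure_eqI)
  let ?T = "\<lambda>p::R3 \<times> R3. norm (fst p) *\<^sub>R snd p"
  show "prob_space (distr pairlaw borel ?T)"
    by (rule pairlaw.prob_space_distr) measurable
  show "prob_space LB" by (rule LB.prob_space_axioms)
  show "distr LB borel g = LB" if "orthogonal_transformation g" for g
    using that by (rule distr_LB_orthogonal)
  show "distr (distr pairlaw borel ?T) borel g = distr pairlaw borel ?T" if g: "orthogonal_transformation g" for g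
  proof (rule measure_eqI)
    note [measurable] = orthogonal_transformation_measurable[OF g]
    fix A assume "A \<in> sets (distr (distr pairlaw borel ?T) borel g)"
    then have [measurable]: "A \<in> sets borel" by simp
    have "emeasure (distr (distr pairlaw borel ?T) borel g) A = (\<integral>\<^sup>+y. indicator A y \<partial>distr pairlaw borel (\<lambda>p. g (?T p)))"
      by (subst distr_distr) (simp_all add: comp_def)
    also have "\<dots> = (\<integral>\<^sup>+p. indicator A (g (?T p)) \<partial>pairlaw)"
      by (rule nn_integral_distr) measurable
    also have "\<dots> = (\<integral>\<^sup>+p. indicator A (?T (g (fst p), g (snd p))) \<partial>pairlaw)"
      by (simp add: orthogonal_transformation_scaleR[OF g] orthogonal_transformation_norm[OF g])
    also have "\<dots> = (\<integral>\<^sup>+p. indicator A (?T p) \<partial>pairlaw)"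
      by (rule nn_integral_pairlaw_orthogonal[OF g, of "\<lambda>p. indicator A (?T p)"]) measurable
    also have "\<dots> = (\<integral>\<^sup>+y. indicator A y \<partial>distr pairlaw borel ?T)"
      by (rule nn_integral_distr[symmetric]) measurable
    also have "\<dots> = emeasure (distr pairlaw borel ?T) A" by simp
    finally show "emeasure (distr (distr pairlaw borel ?T) borel g) A = emeasure (distr pairlaw borel ?T) A" .
  qed simp
  have "distr (distr pairlaw borel ?T) borel norm = distr pairlaw borel (norm \<circ> ?T)"
    by (rule distr_distr) measurable
  also have "\<dots> = distr pairlaw borel (norm \<circ> fst)"
  proof (rule distr_cong_AE)
    show "AE p in pairlaw. (norm \<circ> ?T) p = (norm \<circ> fst) p"
      using AE_pairlaw by eventually_elim simp
  qed simp_all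
  also have "\<dots> = distr (distr pairlaw borel fst) borel norm"
    by (rule distr_distr[symmetric]) measurable
  finally show "distr (distr pairlaw borel ?T) borel norm = distr LB borel norm"
    by (simp add: distr_pairlaw_fst)
qed simp_all

text \<open>The third coordinate is the second one for the circle parametrised by the frame \<open>(v, -u)\<close>.\<close>

lemma cross3_fcirc:
  assumes "x \<noteq> 0"
  shows "cross3 x (fcirc x t) = norm x *\<^sub>R circ (frame_v x) (- frame_u x) t"
proof -
  define u where "u = frame_u x"
  define a where "a = x /\<^sub>R norm x"
  have x: "x = norm x *\<^sub>R a" using assms by (simp add: a_def)
  have "norm a = 1" using assms by (simp add: a_def)
  then have aa: "inner a a = 1" by (simp add: norm_eq_1)
  have au: "inner a u = 0" using frame_u by (simp add: a_def u_def)
  \<comment> \<open>The triple product expansion: multiplying twice by the unit vector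
    \<open>a\<close> is a half turn in the plane orthogonal to \<open>a\<close>, sending
    \<open>u\<close> to \<open>- u\<close>.\<close>
  have "cross3 a (cross3 a u) = inner a u *\<^sub>R a - inner a a *\<^sub>R u"
    by (simp add: cross3_simps forall_3)
  moreover have v: "frame_v x = cross3 a u" by (simp only: frame_v_def a_def u_def)
  ultimately have av: "cross3 a (frame_v x) = - u" by (simp add: aa au)
  have "cross3 a (fcirc x t) = circ (frame_v x) (- u) t"
    unfolding fcirc_def circ_def cross_add_right cross_mult_right u_def[symmetric] av by (simp add: v)
  then show ?thesis
    using x cross_mult_left[of "norm x" a] u_def by metis
qed

text \<open>Given \<open>x\<close>, the vectors \<open>x \<and> y\<close> and \<open>|x| y\<close>
  are uniform on the same circle, merely parametrised by different frames. The third marginal thus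
  reduces to the second.\<close>

lemma distr_pairlaw_cross: "distr pairlaw borel (\<lambda>p. cross3 (fst p) (snd p)) = LB"
proof -
  have "distr pairlaw borel (\<lambda>p. cross3 (fst p) (snd p)) = distr pairlaw borel (\<lambda>p. norm (fst p) *\<^sub>R snd p)"
    (is "?L = ?R")
  proof (rule measure_eqI)
    fix A assume "A \<in> sets ?L"
    then have [measurable]: "A \<in> sets borel" by simp
    have "emeasure ?L A = (\<integral>\<^sup>+y. indicator A y \<partial>?L)" by simp
    also have "\<dots> = (\<integral>\<^sup>+p. indicator A (cross3 (fst p) (snd p)) \<partial>pairlaw)"
      by (rule nn_integral_distr) measurable
    also have "\<dots> = (\<integral>\<^sup>+x. \<integral>\<^sup>+t. indicator A (cross3 x (fcirc x t)) \<partial>angle \<partial>LB)"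
      by (subst nn_integral_pairlaw) simp_all
    also have "\<dots> = (\<integral>\<^sup>+x. \<integral>\<^sup>+t. indicator A (norm x *\<^sub>R fcirc x t) \<partial>angle \<partial>LB)"
    proof (rule nn_integral_cong_AE)
      show "AE x in LB. (\<integral>\<^sup>+t. indicator A (cross3 x (fcirc x t)) \<partial>angle) = (\<integral>\<^sup>+t. indicator A (norm x *\<^sub>R fcirc x t) \<partial>angle)"
        using AE_LB
      proof eventually_elim
        fix x assume "x \<noteq> 0 \<and> x \<in> unitB"
        then have x: "x \<noteq> 0" by simp
        have "(\<integral>\<^sup>+t. indicator A (norm x *\<^sub>R circ (frame_v x) (- frame_u x) t) \<partial>angle)
            = (\<integral>\<^sup>+t. indicator A (norm x *\<^sub>R circ (frame_u x) (frame_v x) t) \<partial>angle)"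
          using frame_uv[OF x]
          by (intro nn_integral_angle_circ_indep[of x] x) (auto simp: orthopair_def inner_commute)
        then show "(\<integral>\<^sup>+t. indicator A (cross3 x (fcirc x t)) \<partial>angle) = (\<integral>\<^sup>+t. indicator A (norm x *\<^sub>R fcirc x t) \<partial>angle)"
          by (simp add: cross3_fcirc[OF x]) (simp add: fcirc_def)
      qed
    qed
    also have "\<dots> = (\<integral>\<^sup>+p. indicator A (norm (fst p) *\<^sub>R snd p) \<partial>pairlaw)"
      by (subst nn_integral_pairlaw) simp_all
    also have "\<dots> = (\<integral>\<^sup>+y. indicator A y \<partial>?R)"
      by (rule nn_integral_distr[symmetric]) measurable
    also have "\<dots> = emeasure ?R A" by simp
    finally show "emeasure ?L A = emeasure ?R A" .
  qed simp
  then show ?thesis by (simp add: distr_pairlaw_scaled)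
qed

definition gammabar :: "(R3 \<times> R3 \<times> R3) measure" where
  "gammabar = distr pairlaw borel (\<lambda>p. (fst p, norm (fst p) *\<^sub>R snd p, cross3 (fst p) (snd p)))"

lemma gammabar_map_measurable [measurable]:
  "(\<lambda>p::R3 \<times> R3. (fst p, norm (fst p) *\<^sub>R snd p, cross3 (fst p) (snd p))) \<in> borel_measurable (borel \<Otimes>\<^sub>M borel)"
  unfolding borel_prod[symmetric] by measurable

lemma measurable_components [measurable]:
  "(\<lambda>p. fst p) \<in> borel_measurable (borel :: (R3 \<times> R3 \<times> R3) measure)"
  "(\<lambda>p. fst (snd p)) \<in> borel_measurable (borel :: (R3 \<times> R3 \<times> R3) measure)"
  "(\<lambda>p. snd (snd p)) \<in> borel_measurable (borel :: (R3 \<times> R3 \<times> R3) measure)"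
  by (intro borel_measurable_continuous_onI continuous_intros)+

lemma gammabar_couplings: "gammabar \<in> couplings3 LB LB LB"
proof -
  have "prob_space gammabar"
    unfolding gammabar_def by (rule pairlaw.prob_space_distr) measurable
  moreover have "distr gammabar borel (\<lambda>p. fst p) = LB"
    unfolding gammabar_def by (subst distr_distr) (simp_all add: comp_def distr_pairlaw_fst)
  moreover have "distr gammabar borel (\<lambda>p. fst (snd p)) = LB"
    unfolding gammabar_def by (subst distr_distr) (simp_all add: comp_def distr_pairlaw_scaled)
  moreover have "distr gammabar borel (\<lambda>p. snd (snd p)) = LB"
    unfolding gammabar_def by (subst distr_distr) (simp_all add: comp_def distr_pairlaw_cross)
  ultimately show ?thesis
    by (simp add: couplings3_def gammabar_def)
qed

section \<open>Upper bound and optimality\<close>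

lemma det3_eq: "det3 x y z = inner x (cross3 y z)"
  unfolding det3_def by (simp add: cross3_simps)

lemma det3_le: "det3 x y z \<le> (norm x ^ 3 + norm y ^ 3 + norm z ^ 3) / 3"
proof -
  have "(norm (cross3 y z))\<^sup>2 \<le> (norm y * norm z)\<^sup>2"
    using norm_cross_dot[of y z] by (smt (verit) zero_le_power2)
  then have "norm (cross3 y z) \<le> norm y * norm z"
    by (rule power2_le_imp_le) simp
  then have "det3 x y z \<le> norm x * (norm y * norm z)"
    unfolding det3_eq using norm_cauchy_schwarz[of x "cross3 y z"]
    by (meson mult_left_mono norm_ge_zero order_trans)
  moreover have "3 * (a * (b * c)) \<le> a ^ 3 + b ^ 3 + c ^ 3" if "0 \<le> a" "0 \<le> b" "0 \<le> c" for a b c :: real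
  proof -
    \<comment> \<open>This product equals \<open>2 * (a^3 + b^3 + c^3 - 3 * a * b * c)\<close>,
      which proves the arithmetic-geometric mean inequality for cubes.\<close>
    have "0 \<le> (a + b + c) * ((a - b)\<^sup>2 + (b - c)\<^sup>2 + (c - a)\<^sup>2)" using that by simp
    then show ?thesis by (simp add: power2_eq_square power3_eq_cube algebra_simps)
  qed
  from this[of "norm x" "norm y" "norm z"] have "3 * (norm x * (norm y * norm z)) \<le> norm x ^ 3 + norm y ^ 3 + norm z ^ 3"
    by simp
  ultimately show ?thesis by simp
qed

lemma integrable_cube_LB: "integrable LB (\<lambda>x. norm x ^ 3)"
proof (rule LB.integrable_const_bound[of _ 1])
  show "AE x in LB. norm (norm x ^ 3) \<le> 1"
    using AE_LB by eventually_elim (simp add: unitB_def power_le_one)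
qed measurable

lemma integral_det3_coupling_le:
  assumes "\<gamma> \<in> couplings3 LB LB LB"
  shows "(\<integral>p. det3 (fst p) (fst (snd p)) (snd (snd p)) \<partial>\<gamma>) \<le> (\<integral>x. norm x ^ 3 \<partial>LB)"
proof -
  let ?k = "\<lambda>x::R3. norm x ^ 3"
  have [measurable_cong]: "sets \<gamma> = sets borel"
    and d: "distr \<gamma> borel (\<lambda>p. fst p) = LB" "distr \<gamma> borel (\<lambda>p. fst (snd p)) = LB"
      "distr \<gamma> borel (\<lambda>p. snd (snd p)) = LB"
    using assms by (auto simp: couplings3_def)
  have coord: "integrable \<gamma> (\<lambda>p. ?k (T p))" "(\<integral>p. ?k (T p) \<partial>\<gamma>) = (\<integral>x. ?k x \<partial>LB)"
    if "distr \<gamma> borel T = LB" and [measurable]: "T \<in> borel_measurable borel" for T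
    using integrable_distr_eq[of T \<gamma> borel ?k] integral_distr[of T \<gamma> borel ?k] integrable_cube_LB that
    by simp_all
  note c = coord[OF d(1)] coord[OF d(2)] coord[OF d(3)]
  \<comment> \<open>The majorant is integrable and nonnegative, which is enough for the comparison:
    a left integrand that failed to be integrable would have integral 0.\<close>
  have "(\<integral>p. det3 (fst p) (fst (snd p)) (snd (snd p)) \<partial>\<gamma>)
      \<le> (\<integral>p. (?k (fst p) + ?k (fst (snd p)) + ?k (snd (snd p))) / 3 \<partial>\<gamma>)"
    by (rule integral_mono') (use c det3_le in auto)
  also have "\<dots> = (\<integral>x. ?k x \<partial>LB)"
    using c by simp
  finally show ?thesis .
qed

lemma integral_det3_gammabar:
  "(\<integral>p. det3 (fst p) (fst (snd p)) (snd (snd p)) \<partial>gammabar) = (\<integral>x. norm x ^ 3 \<partial>LB)"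
proof -
  have "(\<integral>p. det3 (fst p) (fst (snd p)) (snd (snd p)) \<partial>gammabar)
      = (\<integral>p. det3 (fst p) (norm (fst p) *\<^sub>R snd p) (cross3 (fst p) (snd p)) \<partial>pairlaw)"
    unfolding gammabar_def det3_eq by (subst integral_distr) simp_all
  also have "\<dots> = (\<integral>p. norm (fst p) ^ 3 \<partial>pairlaw)"
  proof (rule integral_cong_AE)
    show "AE p in pairlaw. det3 (fst p) (norm (fst p) *\<^sub>R snd p) (cross3 (fst p) (snd p)) = norm (fst p) ^ 3"
      using AE_pairlaw
    proof eventually_elim
      case (elim p)
      let ?x = "fst p" and ?y = "snd p"
      \<comment> \<open>Cyclic invariance of the triple product makes the left side the squared norm
        of the cross product, and the equation is Lagrange's identity; orthogonality then removes
        the last term.\<close>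
      have "inner ?x (cross3 ?y (cross3 ?x ?y)) = inner ?x ?x * inner ?y ?y - (inner ?x ?y)\<^sup>2"
        by (simp add: cross3_simps power2_eq_square)
      also have "\<dots> = norm ?x ^ 2"
        using elim by (simp add: power2_norm_eq_inner norm_eq_1)
      finally show ?case
        by (simp add: det3_eq cross_mult_left power3_eq_cube power2_eq_square)
    qed
  qed (unfold det3_eq, measurable)
  also have "\<dots> = (\<integral>x. norm x ^ 3 \<partial>distr pairlaw borel fst)"
    by (rule integral_distr[symmetric]) measurable
  finally show ?thesis by (simp add: distr_pairlaw_fst)
qed

lemma gammabar_solution: "is_solution gammabar"
  unfolding is_solution_def
  using gammabar_couplings integral_det3_coupling_le by (simp add: integral_det3_gammabar)

lemma integral_LB:
  fixes h :: "R3 \<Rightarrow> real"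
  assumes [measurable]: "h \<in> borel_measurable borel"
  shows "(\<integral>x. h x \<partial>LB) = 1 / measure lborel unitB * (LINT x : unitB | lborel. h x)"
proof -
  let ?m = "measure lborel unitB"
  have LB_eq: "LB = density lborel (\<lambda>x. ennreal (indicator unitB x / ?m))"
    unfolding LB_def uniform_measure_def emeasure_unitB using measure_unitB_pos
    by (intro density_cong) (auto simp: divide_ennreal ennreal_1[symmetric] simp del: ennreal_1 split: split_indicator)
  have "(\<integral>x. h x \<partial>LB) = (\<integral>x. (indicator unitB x / ?m) *\<^sub>R h x \<partial>lborel)"
    unfolding LB_eq by (rule integral_density) (auto simp: measure_nonneg)
  also have "\<dots> = (\<integral>x. (1 / ?m) * (indicator unitB x *\<^sub>R h x) \<partial>lborel)"
    by (intro Bochner_Integration.integral_cong) auto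
  finally show ?thesis
    by (simp add: set_lebesgue_integral_def)
qed

theorem theorem2p1:
  shows "\<exists>\<gamma>. is_solution \<gamma> \<and>
    (\<forall>f :: R3 \<times> R3 \<times> R3 \<Rightarrow> real.
       continuous_on (Sigma unitB (\<lambda>_. Sigma unitB (\<lambda>_. unitB))) f \<longrightarrow>
       (LINT p : Sigma unitB (\<lambda>_. Sigma unitB (\<lambda>_. unitB)) | \<gamma>. f p) =
       1 / measure lborel unitB *
         (LINT x : unitB | lborel.
            (LINT y : Scirc x | H1. f (x, norm x *\<^sub>R y, cross3 x y) / (2 * pi))))"
proof (intro exI[of _ gammabar] conjI gammabar_solution allI impI)
  fix f :: "R3 \<times> R3 \<times> R3 \<Rightarrow> real"
  let ?B3 = "Sigma unitB (\<lambda>_. Sigma unitB (\<lambda>_. unitB))"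
  assume f: "continuous_on ?B3 f"
  have compB: "compact ?B3" by (intro compact_Times) (auto simp: unitB_def)
  \<comment> \<open>\<open>f\<close> is only known to be continuous on the compact product of balls.
    Its extension by zero is a bounded Borel function on the whole space, as required for
    push-forwards and Fubini.\<close>
  define F where "F p = indicator ?B3 p *\<^sub>R f p" for p
  define T where "T x y = (x, norm x *\<^sub>R y, cross3 x y)" for x y :: R3
  have F[measurable]: "F \<in> borel_measurable borel"
    unfolding F_def using f compB
    by (intro borel_measurable_continuous_on_indicator borel_closed compact_imp_closed)
  have T[measurable]: "(\<lambda>p. T (fst p) (snd p)) \<in> borel_measurable (borel \<Otimes>\<^sub>M borel)"
    unfolding T_def by (rule gammabar_map_measurable)
  obtain K where K: "\<And>p. p \<in> ?B3 \<Longrightarrow> \<bar>f p\<bar> \<le> K"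
    using compact_imp_bounded[OF compact_continuous_image[OF f compB]] by (auto simp: bounded_iff)
  have bound: "norm (F p) \<le> \<bar>K\<bar>" for p
    using K[of p] by (auto simp: F_def split: split_indicator)
  have FT[measurable]: "(\<lambda>p. F (T (fst p) (fcirc (fst p) (snd p)))) \<in> borel_measurable (borel \<Otimes>\<^sub>M borel)"
  proof -
    have "(\<lambda>p. (fst p, fcirc (fst p) (snd p))) \<in> (borel \<Otimes>\<^sub>M borel) \<rightarrow>\<^sub>M (borel \<Otimes>\<^sub>M borel)"
      by measurable
    from measurable_compose[OF measurable_compose[OF this T] F] show ?thesis by simp
  qed
  have Ty[measurable]: "(\<lambda>y. F (T x y)) \<in> borel_measurable borel" for x
  proof -
    have "(\<lambda>y. (x, y)) \<in> borel \<rightarrow>\<^sub>M (borel \<Otimes>\<^sub>M borel)" by measurable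
    from measurable_compose[OF measurable_compose[OF this T] F] show ?thesis by simp
  qed
  have int: "integrable (LB \<Otimes>\<^sub>M angle) (\<lambda>p. F (T (fst p) (fcirc (fst p) (snd p))))"
    using bound by (intro LB_angle.integrable_const_bound[of _ "\<bar>K\<bar>"]) auto
  have "(LINT p : ?B3 | gammabar. f p) = (\<integral>p. F p \<partial>gammabar)"
    by (simp add: set_lebesgue_integral_def F_def)
  also have "\<dots> = (\<integral>p. F (T (fst p) (snd p)) \<partial>pairlaw)"
    unfolding gammabar_def T_def by (rule integral_distr) measurable
  also have "\<dots> = (\<integral>p. F (T (fst p) (fcirc (fst p) (snd p))) \<partial>(LB \<Otimes>\<^sub>M angle))"
    unfolding pairlaw_def by (subst integral_distr) (simp_all add: measurable_compose[OF T F])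
  also have "\<dots> = (\<integral>x. (\<integral>t. F (T x (fcirc x t)) \<partial>angle) \<partial>LB)"
    using LB_angle.integral_fst'[OF int] by simp
  also have "\<dots> = 1 / measure lborel unitB * (LINT x : unitB | lborel. (\<integral>t. F (T x (fcirc x t)) \<partial>angle))"
  proof (rule integral_LB)
    have "(\<lambda>x. \<integral>t. F (T (fst (x, t)) (fcirc (fst (x, t)) (snd (x, t)))) \<partial>angle) \<in> borel_measurable borel"
      using FT by (intro angle.borel_measurable_lebesgue_integral) (simp add: split_beta')
    then show "(\<lambda>x. \<integral>t. F (T x (fcirc x t)) \<partial>angle) \<in> borel_measurable borel" by simp
  qed
  also have "(LINT x : unitB | lborel. (\<integral>t. F (T x (fcirc x t)) \<partial>angle))
      = (LINT x : unitB | lborel. (LINT y : Scirc x | H1. f (x, norm x *\<^sub>R y, cross3 x y) / (2 * pi)))"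
    unfolding set_lebesgue_integral_def[of lborel]
  \<comment> \<open>The integrands are compared off the origin only, a null set:
    \<open>Scirc 0\<close> is the whole unit sphere and not a circle.\<close>
  proof (rule integral_discrete_difference[of "{0}"])
    fix x :: R3 assume "x \<notin> {0}"
    then have x: "x \<noteq> 0" by simp
    have "(\<integral>t. F (T x (fcirc x t)) \<partial>angle) = (LINT y : Scirc x | H1. f (x, norm x *\<^sub>R y, cross3 x y) / (2 * pi))"
      if xB: "x \<in> unitB"
    proof -
      have "(\<integral>t. F (T x (fcirc x t)) \<partial>angle) = (LINT y : Scirc x | H1. F (T x y) / (2 * pi))"
        unfolding fcirc_def using frame_uv[OF x] x by (intro integral_angle_circ) auto
      also have "\<dots> = (LINT y : Scirc x | H1. f (x, norm x *\<^sub>R y, cross3 x y) / (2 * pi))"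
        unfolding set_lebesgue_integral_def
      proof (intro Bochner_Integration.integral_cong refl)
        fix y
        show "indicator (Scirc x) y *\<^sub>R (F (T x y) / (2 * pi))
            = indicator (Scirc x) y *\<^sub>R (f (x, norm x *\<^sub>R y, cross3 x y) / (2 * pi))"
        proof (cases "y \<in> Scirc x")
          case True
          then have y: "norm y = 1" "inner x y = 0" by (auto simp: Scirc_def)
          \<comment> \<open>For \<open>y\<close> on the circle all three components have norm
            \<open>|x|\<close>, so the triple stays in the product of balls, where \<open>F\<close>
            agrees with \<open>f\<close>.\<close>
          have "(norm (cross3 x y))\<^sup>2 = (norm x)\<^sup>2" using norm_cross_dot[of x y] y by simp
          then have "norm (cross3 x y) = norm x" by simp
          then have "T x y \<in> ?B3" using xB y by (auto simp: T_def unitB_def)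
          then show ?thesis by (simp add: F_def T_def)
        qed simp
      qed
      finally show ?thesis .
    qed
    then show "indicator unitB x *\<^sub>R (\<integral>t. F (T x (fcirc x t)) \<partial>angle)
        = indicator unitB x *\<^sub>R (LINT y : Scirc x | H1. f (x, norm x *\<^sub>R y, cross3 x y) / (2 * pi))"
      by (auto split: split_indicator)
  qed auto
  finally show "(LINT p : ?B3 | gammabar. f p) = 1 / measure lborel unitB *
      (LINT x : unitB | lborel. (LINT y : Scirc x | H1. f (x, norm x *\<^sub>R y, cross3 x y) / (2 * pi)))" .
qed

end
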